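(* Let $k,l,m,n$ be integers such that $n=k(m-l)+l$, where $k\geq 1$, $m\geq 2$ and $\lceil \frac{m}{2}\rceil\leq l<m$, and suppose $m\equiv s\pmod{m-l}$ with $s$ an integer such that $1\leq s<m-l$. Let $K$ be a field, $R=K[x_1,\dots,x_n]$, and let $I_{m,l,k}=(u_1,\dots,u_k)\subseteq R$ with $u_i=\prod_{j=1}^{m}x_{(i-1)(m-l)+j}$ for $1\leq i\leq k$. Then $$\mathrm{depth}(I_{m,l,k})=n+2-\left\lceil \frac{n+m-l-s}{2m-l-s}\right\rceil-\left\lfloor \frac{n+m-l-s}{2m-l-s}\right\rfloor.$$
   Context: $R$ is graded in the standard way ($\deg x_i=1$); $\lceil a\rceil$ denotes the smallest integer $\ge a$ and $\lfloor a\rfloor$ the largest integer $\le a$. Here $\mathrm{depth}(I)$ denotes the depth of the ideal $I$ viewed as a graded $R$-module (with respect to the homogeneous maximal ideal $(x_1,\dots,x_n)$), not the depth of $R/I$. *)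

theory Defs
  imports
    "HOL-Algebra.Ideal"
    "HOL-Algebra.Module"
    "HOL-Library.Poly_Mapping"
    "HOL-Library.Extended_Real"
    "HOL-Number_Theory.Cong"
begin

text \<open>
  Exponent vectors are finitely supported functions on the naturals, so the type below contains
  the polynomials in countably many variables. The ring in the variables \<open>x\<^sub>1, \<dots>, x\<^sub>n\<close> is
  carved out by restricting the support of the exponents.
\<close>

type_synonym 'a mpol = "(nat \<Rightarrow>\<^sub>0 nat) \<Rightarrow>\<^sub>0 'a"

definition X :: "nat \<Rightarrow> 'a::field mpol" where
  "X i = Poly_Mapping.single (Poly_Mapping.single i 1) 1"

definition poly_ring :: "'a::field itself \<Rightarrow> nat \<Rightarrow> 'a mpol ring" where
  "poly_ring K n =
    \<lparr>carrier = {p. \<forall>t \<in> Poly_Mapping.keys p. Poly_Mapping.keys t \<subseteq> {1..n}},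
     monoid.mult = (*), one = 1, zero = 0, add = (+)\<rparr>"

definition irrelevant_ideal :: "'a::field itself \<Rightarrow> nat \<Rightarrow> 'a mpol set" where
  "irrelevant_ideal K n = Idl\<^bsub>poly_ring K n\<^esub> (X ` {1..n})"

text \<open>The fields \<open>mult\<close> and \<open>one\<close> of a module record play no role.\<close>

definition ideal_module :: "('a, 'm) ring_scheme \<Rightarrow> 'a set \<Rightarrow> ('a, 'a) module" where
  "ideal_module R J =
    \<lparr>carrier = J, monoid.mult = (\<otimes>\<^bsub>R\<^esub>), one = \<one>\<^bsub>R\<^esub>, zero = \<zero>\<^bsub>R\<^esub>, add = (\<oplus>\<^bsub>R\<^esub>), smult = (\<otimes>\<^bsub>R\<^esub>)\<rparr>"

text \<open>The submodule \<open>(f\<^sub>1, \<dots>, f\<^sub>r)M = f\<^sub>1 M + \<dots> + f\<^sub>r M\<close>.\<close>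

definition seq_submodule :: "('a, 'b, 'm) module_scheme \<Rightarrow> 'a list \<Rightarrow> 'b set" where
  "seq_submodule M fs =
    {\<Oplus>\<^bsub>M\<^esub>j \<in> {..<length fs}. (fs ! j) \<odot>\<^bsub>M\<^esub> w j | w. w \<in> {..<length fs} \<rightarrow> carrier M}"

text \<open>
  The quantified condition says that multiplication by \<open>f\<^sub>i\<close> is injective on
  \<open>M / (f\<^sub>1, \<dots>, f\<^sub>i\<^sub>-\<^sub>1)M\<close>; the other one that \<open>M / (f\<^sub>1, \<dots>, f\<^sub>r)M\<close> is nonzero.
\<close>

definition regular_sequence ::
  "('a, 'm) ring_scheme \<Rightarrow> ('a, 'b, 'q) module_scheme \<Rightarrow> 'a list \<Rightarrow> bool" where
  "regular_sequence R M fs \<longleftrightarrow>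
     set fs \<subseteq> carrier R \<and>
     (\<forall>i < length fs. \<forall>v \<in> carrier M.
        (fs ! i) \<odot>\<^bsub>M\<^esub> v \<in> seq_submodule M (take i fs) \<longrightarrow> v \<in> seq_submodule M (take i fs)) \<and>
     seq_submodule M fs \<noteq> carrier M"

text \<open>
  The depth of \<open>M\<close> with respect to the ideal \<open>J\<close> is the supremum of the lengths of the
  \<open>M\<close>-regular sequences in \<open>J\<close>. It is only meant for \<open>JM \<noteq> M\<close>; in particular the zero module
  gets the value 0 here.
\<close>

definition depth ::
  "('a, 'm) ring_scheme \<Rightarrow> 'a set \<Rightarrow> ('a, 'b, 'q) module_scheme \<Rightarrow> enat" where
  "depth R J M = Sup {enat (length fs) | fs. set fs \<subseteq> J \<and> regular_sequence R M fs}"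

definition path_gen :: "nat \<Rightarrow> nat \<Rightarrow> nat \<Rightarrow> 'a::field mpol" where
  "path_gen m l i = (\<Prod>j = 1..m. X ((i - 1) * (m - l) + j))"

text \<open>The ideal \<open>I\<^sub>m\<^sub>,\<^sub>l\<^sub>,\<^sub>k\<close> of \<open>K[x\<^sub>1, \<dots>, x\<^sub>n]\<close>; it is meant for \<open>n = k(m - l) + l\<close>.\<close>

definition path_ideal :: "'a::field itself \<Rightarrow> nat \<Rightarrow> nat \<Rightarrow> nat \<Rightarrow> nat \<Rightarrow> 'a mpol set" where
  "path_ideal K n m l k = Idl\<^bsub>poly_ring K n\<^esub> (path_gen m l ` {1..k})"

lemma poly_ring_cring: "cring (poly_ring (K :: 'a::field itself) n)"
proof -
  define C where
    "C = {p :: 'a mpol. \<forall>t \<in> Poly_Mapping.keys p. Poly_Mapping.keys t \<subseteq> {1..n}}"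
  have zero: "0 \<in> C" and one: "1 \<in> C"
    by (simp_all add: C_def)
  have add: "p + q \<in> C" if "p \<in> C" "q \<in> C" for p q
    using that Poly_Mapping.keys_add[of p q] unfolding C_def by blast
  have mult: "p * q \<in> C" if pq: "p \<in> C" "q \<in> C" for p q
  proof -
    have "Poly_Mapping.keys t \<subseteq> {1..n}" if t: "t \<in> Poly_Mapping.keys (p * q)" for t
    proof -
      obtain a b where ab: "t = a + b" "a \<in> Poly_Mapping.keys p" "b \<in> Poly_Mapping.keys q"
        using t keys_mult[of p q] by blast
      then show ?thesis
        using pq Poly_Mapping.keys_add[of a b] unfolding C_def by blast
    qed
    then show ?thesis unfolding C_def by blast
  qed
  have uminus: "- p \<in> C" if "p \<in> C" for p
    using that by (simp add: C_def)
  define S :: "'a mpol ring" where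
    "S = \<lparr>carrier = C, monoid.mult = (*), one = 1, zero = 0, add = (+)\<rparr>"
  have S: "carrier S = C" "monoid.mult S = (*)" "\<one>\<^bsub>S\<^esub> = 1" "\<zero>\<^bsub>S\<^esub> = 0" "add S = (+)"
    by (simp_all add: S_def)
  have "abelian_group S"
  proof (rule abelian_groupI)
    fix p assume "p \<in> carrier S"
    then show "\<exists>q \<in> carrier S. q \<oplus>\<^bsub>S\<^esub> p = \<zero>\<^bsub>S\<^esub>"
      using uminus[of p] by (intro bexI[of _ "- p"]) (simp_all add: S)
  qed (simp_all add: S zero add add.assoc add.commute)
  moreover have "comm_monoid S"
    by (rule comm_monoidI) (simp_all add: S one mult mult.assoc mult.commute)
  ultimately have "cring S"
    by (rule cringI) (simp add: S distrib_right)
  then show ?thesis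
    by (simp add: poly_ring_def S_def C_def)
qed

lemma ideal_module_module:
  assumes "cring R" and "ideal J R"
  shows "Module.module R (ideal_module R J)"
proof -
  interpret cring R by fact
  interpret J: ideal J R by fact
  have closed: "x \<in> carrier R" if "x \<in> J" for x
    using that J.a_subset by blast
  show ?thesis
  proof (rule Module.moduleI)
    show "abelian_group (ideal_module R J)"
    proof (rule abelian_groupI)
      fix x assume "x \<in> carrier (ideal_module R J)"
      then have x: "x \<in> J" by (simp add: ideal_module_def)
      then have "\<ominus>\<^bsub>R\<^esub> x \<in> J" by (rule J.a_inv_closed)
      then show "\<exists>y \<in> carrier (ideal_module R J).
          y \<oplus>\<^bsub>ideal_module R J\<^esub> x = \<zero>\<^bsub>ideal_module R J\<^esub>"
        using l_neg[OF closed[OF x]] by (intro bexI[of _ "\<ominus>\<^bsub>R\<^esub> x"]) (simp_all add: ideal_module_def)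
    next
      fix x y assume "x \<in> carrier (ideal_module R J)" "y \<in> carrier (ideal_module R J)"
      then show "x \<oplus>\<^bsub>ideal_module R J\<^esub> y = y \<oplus>\<^bsub>ideal_module R J\<^esub> x"
        using closed by (simp add: ideal_module_def a_comm)
    qed (simp_all add: ideal_module_def closed a_assoc J.a_closed)
  qed (simp_all add: ideal_module_def closed is_cring J.I_l_closed l_distr r_distr m_assoc)
qed

end

theory Submission
  imports Defs
begin

text \<open>
  The generators are the intervals \<open>E\<^sub>i = {(i - 1)d + 1, \<dots>, (i - 1)d + m}\<close> with
  \<open>d = m - l\<close> and \<open>m = qd + s\<close>. Writing \<open>k - 1 = a(q + 1) + r\<close> with \<open>r \<le> q\<close>, the claim
  is that the depth is \<open>n - p\<close> with \<open>p = 2a\<close> for \<open>r = 0\<close> and \<open>p = 2a + 1\<close> otherwise.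

  An \<open>I\<close>-regular sequence of length \<open>t\<close> in the maximal ideal turns a nonzero class in the Koszul
  homology \<open>H\<^sub>p(x; I)\<close> into a nonzero class in degree \<open>p + t\<close> for a quotient of \<open>I\<close>, so \<open>p + t \<le> n\<close>. The
  class is the boundary of \<open>x\<^sub>F/x\<^sub>C e\<^sub>C\<close>, where \<open>C\<close> is a minimal transversal of consecutive
  intervals \<open>D\<^sub>0, \<dots>, D\<^sub>p\<close> with union \<open>F\<close> such that each \<open>E\<^sub>i\<close> contains some \<open>D\<^sub>j\<close>; summing
  coefficients over the transversals of \<open>D\<^sub>0, \<dots>, D\<^sub>p\<^sub>-\<^sub>1\<close> detects it.

  Conversely, the elementary symmetric polynomials \<open>e\<^sub>1, \<dots>, e\<^sub>n\<^sub>-\<^sub>p\<close> are \<open>I\<close>-regular. Modulo a prime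
  \<open>(x\<^sub>c : c \<in> C)\<close> the first \<open>n - |C|\<close> of them are regular, and regularity on \<open>R/(A : x)\<close> and
  \<open>R/(A + (x))\<close> gives regularity on \<open>R/A\<close>. Splitting off variables of the first remaining edge in
  decreasing order reaches only primes with \<open>|C| \<le> p + 1\<close>, which yields \<open>n - p - 1\<close> regular
  elements on \<open>R/I\<close> and hence \<open>n - p\<close> on \<open>I\<close>.
\<close>

text \<open>The terms cancel in pairs. The predicate \<open>Q\<close> picks one member of each pair
  and so excludes fixed points, where \<open>G x = - G x\<close> would not force
  \<open>G x = 0\<close> in characteristic 2.\<close>

lemma sum_involution_eq_0:
  fixes G :: "'c \<Rightarrow> 'b::ab_group_add"
  assumes "finite P"
    and inv: "\<And>x. x \<in> P \<Longrightarrow> \<iota> x \<in> P" "\<And>x. x \<in> P \<Longrightarrow> \<iota> (\<iota> x) = x"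
    and neg: "\<And>x. x \<in> P \<Longrightarrow> G (\<iota> x) = - G x"
    and Q: "\<And>x. x \<in> P \<Longrightarrow> Q (\<iota> x) \<longleftrightarrow> \<not> Q x"
  shows "sum G P = 0"
proof -
  have "sum G {x \<in> P. \<not> Q x} = sum (\<lambda>x. G (\<iota> x)) {x \<in> P. Q x}"
    by (rule sum.reindex_bij_witness[of _ \<iota> \<iota>]) (auto simp: inv Q)
  also have "\<dots> = - sum G {x \<in> P. Q x}"
    by (simp add: neg sum_negf)
  finally have "sum G {x \<in> P. \<not> Q x} + sum G {x \<in> P. Q x} = 0" by simp
  moreover have "sum G P = sum G {x \<in> P. \<not> Q x} + sum G {x \<in> P. Q x}"
    using \<open>finite P\<close> by (subst sum.union_disjoint[symmetric]) (auto intro!: sum.cong)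
  ultimately show ?thesis by simp
qed

section \<open>Weakly regular sequences\<close>

text \<open>This is \<open>A + f 0 M + ... + f (i - 1) M\<close>. For \<open>M = R\<close> it is the
  preimage in \<open>R\<close> of the ideal \<open>(f)\<close> of \<open>R/A\<close>; for
  \<open>A = {0}\<close> it is the submodule \<open>(f)M\<close>. Both cases occur below.\<close>

primrec extend_seq :: "'b::comm_ring_1 set \<Rightarrow> (nat \<Rightarrow> 'b) \<Rightarrow> 'b set \<Rightarrow> nat \<Rightarrow> 'b set" where
  "extend_seq M f A 0 = A"
| "extend_seq M f A (Suc i) = {a + f i * w | a w. a \<in> extend_seq M f A i \<and> w \<in> M}"

lemma extend_SucI: "a \<in> extend_seq M f A i \<Longrightarrow> w \<in> M \<Longrightarrow> a + f i * w \<in> extend_seq M f A (Suc i)"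
  by auto

text \<open>Regularity on \<open>M/A\<close>, expressed by representatives. The last quotient may be
  zero, because splitting an ideal at variables eventually produces the unit ideal.\<close>

definition wreg :: "'b::comm_ring_1 set \<Rightarrow> (nat \<Rightarrow> 'b) \<Rightarrow> 'b set \<Rightarrow> nat \<Rightarrow> bool" where
  "wreg M f A r \<longleftrightarrow> (\<forall>i<r. \<forall>v\<in>M. f i * v \<in> extend_seq M f A i \<longrightarrow> v \<in> extend_seq M f A i)"

lemma wregD: "wreg M f A r \<Longrightarrow> i < r \<Longrightarrow> v \<in> M \<Longrightarrow> f i * v \<in> extend_seq M f A i \<Longrightarrow> v \<in> extend_seq M f A i"
  by (auto simp: wreg_def)

lemma wreg_mono: "wreg M f A r \<Longrightarrow> i \<le> r \<Longrightarrow> wreg M f A i"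
  by (auto simp: wreg_def)

text \<open>The base ring is a subset because the polynomials in \<open>n\<close> variables do not
  exhaust their type.\<close>

locale subring_carrier =
  fixes R :: "'b::comm_ring_1 set"
  assumes zero_closed: "0 \<in> R" and one_closed: "1 \<in> R"
    and add_closed: "\<And>a b. a \<in> R \<Longrightarrow> b \<in> R \<Longrightarrow> a + b \<in> R"
    and mult_closed: "\<And>a b. a \<in> R \<Longrightarrow> b \<in> R \<Longrightarrow> a * b \<in> R"
    and uminus_closed: "\<And>a. a \<in> R \<Longrightarrow> - a \<in> R"
begin

definition idl :: "'b set \<Rightarrow> bool" where
  "idl A \<longleftrightarrow> A \<subseteq> R \<and> 0 \<in> A \<and> (\<forall>a\<in>A. \<forall>b\<in>A. a + b \<in> A) \<and> (\<forall>r\<in>R. \<forall>a\<in>A. r * a \<in> A)"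

lemma idl_R: "idl R"
  using zero_closed add_closed mult_closed by (auto simp: idl_def)

lemma idl_0: "idl {0}"
  using zero_closed by (auto simp: idl_def)

lemma idlD:
  assumes "idl A"
  shows "a \<in> A \<Longrightarrow> a \<in> R" "0 \<in> A" "a \<in> A \<Longrightarrow> b \<in> A \<Longrightarrow> a + b \<in> A" "r \<in> R \<Longrightarrow> a \<in> A \<Longrightarrow> r * a \<in> A"
  using assms by (auto simp: idl_def)

lemma idl_mult_right: "idl A \<Longrightarrow> r \<in> R \<Longrightarrow> a \<in> A \<Longrightarrow> a * r \<in> A"
  using idlD(4)[of A r a] by (simp add: mult.commute)

lemma idl_uminus:
  assumes "idl A" "a \<in> A" shows "- a \<in> A"
  using idlD(4)[OF assms(1) uminus_closed[OF one_closed] assms(2)] by simp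

lemma idl_diff: "idl A \<Longrightarrow> a \<in> A \<Longrightarrow> b \<in> A \<Longrightarrow> a - b \<in> A"
  using idlD(3)[of A a "- b"] idl_uminus[of A b] by simp

lemma idl_sum:
  assumes "idl A" "\<And>i. i \<in> I \<Longrightarrow> g i \<in> A" shows "sum g I \<in> A"
  using assms(2) by (induction I rule: infinite_finite_induct) (auto intro: idlD[OF assms(1)])

lemma idl_extend:
  assumes A: "idl A" and M: "idl M" and f: "\<And>i. f i \<in> R"
  shows "idl (extend_seq M f A i)"
proof (induction i)
  case 0
  then show ?case using A by simp
next
  case (Suc i)
  let ?E = "extend_seq M f A (Suc i)"
  have 1: "?E \<subseteq> R"
    using idlD(1)[OF Suc] idlD(1)[OF M] f by (auto intro!: add_closed mult_closed)
  have 2: "0 \<in> ?E" using extend_SucI[of 0 M f A i 0] idlD(2)[OF Suc] idlD(2)[OF M] by simp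
  have 3: "x + y \<in> ?E" if xy: "x \<in> ?E" "y \<in> ?E" for x y
  proof -
    obtain a w where x: "x = a + f i * w" "a \<in> extend_seq M f A i" "w \<in> M"
      using xy(1) by auto
    obtain b v where y: "y = b + f i * v" "b \<in> extend_seq M f A i" "v \<in> M"
      using xy(2) by auto
    have "x + y = (a + b) + f i * (w + v)" using x y by (simp add: algebra_simps)
    then show ?thesis using extend_SucI[OF idlD(3)[OF Suc x(2) y(2)] idlD(3)[OF M x(3) y(3)]] by simp
  qed
  have 4: "r * x \<in> ?E" if rx: "r \<in> R" "x \<in> ?E" for r x
  proof -
    obtain a w where x: "x = a + f i * w" "a \<in> extend_seq M f A i" "w \<in> M"
      using rx(2) by auto
    have "r * x = (r * a) + f i * (r * w)" using x by (simp add: algebra_simps)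
    then show ?thesis using extend_SucI[OF idlD(4)[OF Suc rx(1) x(2)] idlD(4)[OF M rx(1) x(3)]] by simp
  qed
  show ?case unfolding idl_def using 1 2 3 4 by blast
qed

lemma subset_extend:
  assumes "idl M" shows "A \<subseteq> extend_seq M f A i"
proof (induction i)
  case (Suc i)
  have "a \<in> extend_seq M f A (Suc i)" if "a \<in> A" for a
    using extend_SucI[of a M f A i 0] Suc that idlD(2)[OF assms] by auto
  then show ?case by blast
qed simp

lemma extend_mono: "A \<subseteq> B \<Longrightarrow> M \<subseteq> N \<Longrightarrow> extend_seq M f A i \<subseteq> extend_seq N f B i"
  by (induction i) (auto, blast)

lemma extend_iff:
  assumes "idl M"
  shows "y \<in> extend_seq M f A i \<longleftrightarrow> (\<exists>a\<in>A. \<exists>s\<in>extend_seq M f {0} i. y = a + s)"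
proof (induction i arbitrary: y)
  case (Suc i)
  show ?case
  proof
    assume "y \<in> extend_seq M f A (Suc i)"
    then obtain a w where "y = a + f i * w" "a \<in> extend_seq M f A i" "w \<in> M" by auto
    moreover from this obtain b s where "b \<in> A" "s \<in> extend_seq M f {0} i" "a = b + s"
      using Suc by blast
    ultimately show "\<exists>a\<in>A. \<exists>s\<in>extend_seq M f {0} (Suc i). y = a + s"
      by (intro bexI[of _ b] bexI[of _ "s + f i * w"]) (auto simp: add.assoc)
  next
    assume "\<exists>a\<in>A. \<exists>s\<in>extend_seq M f {0} (Suc i). y = a + s"
    then obtain a s w where "a \<in> A" "s \<in> extend_seq M f {0} i" "w \<in> M" "y = a + (s + f i * w)" by auto
    moreover from this have "a + s \<in> extend_seq M f A i" using Suc by blast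
    ultimately show "y \<in> extend_seq M f A (Suc i)"
      using extend_SucI[of "a + s" M f A i w] by (simp only: add.assoc)
  qed
qed auto

text \<open>The vanishing of \<open>Tor\<^sub>1(R/A, R/(f\<^sub>0, \<dots>, f\<^sub>i\<^sub>-\<^sub>1))\<close>.\<close>

lemma extend_inter:
  assumes A: "idl A" and f: "\<And>i. f i \<in> R"
    and "wreg R f A i" "s \<in> extend_seq R f {0} i" "s \<in> A"
  shows "s \<in> extend_seq A f {0} i"
  using assms(3-5)
proof (induction i arbitrary: s)
  case (Suc i)
  have ext0: "idl (extend_seq R f {0} i)" by (rule idl_extend[OF idl_0 idl_R f])
  obtain s' w where s: "s = s' + f i * w" "s' \<in> extend_seq R f {0} i" "w \<in> R"
    using Suc.prems by auto
  have "f i * w = s + (- s')" using s by simp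
  then have "f i * w \<in> extend_seq R f A i"
    using Suc.prems(3) idl_uminus[OF ext0 s(2)] extend_iff[OF idl_R] by blast
  then have "w \<in> extend_seq R f A i" using wregD[OF Suc.prems(1)] s(3) by blast
  then obtain y t where w: "w = y + t" "y \<in> A" "t \<in> extend_seq R f {0} i"
    using extend_iff[OF idl_R] by blast
  have e1: "s' + f i * t \<in> extend_seq R f {0} i"
    by (intro idlD(3)[OF ext0] idlD(4)[OF ext0] s w f)
  \<comment> \<open>Regrouping replaces the last coefficient \<open>w\<close> by \<open>y\<close>,
    which lies in \<open>A\<close>. The remainder lies in \<open>A\<close> and involves only the
    earlier elements, so the induction hypothesis applies to it.\<close>
  have eq: "s = (s' + f i * t) + f i * y" using s w by (simp add: algebra_simps)
  then have "s' + f i * t = s - f i * y" by simp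
  then have "s' + f i * t \<in> A"
    using idl_diff[OF A Suc.prems(3) idlD(4)[OF A f w(2)]] by simp
  then have "s' + f i * t \<in> extend_seq A f {0} i"
    using Suc.IH e1 wreg_mono[OF Suc.prems(1)] by simp
  then show ?case using eq w(2) by auto
qed simp

text \<open>Regularity on \<open>R\<close> puts \<open>v\<close> into the intersection of
  \<open>A\<close> with \<open>(f)R\<close>, which is \<open>(f)A\<close> by
  \<open>extend_inter\<close>. At index \<open>i\<close> that lemma uses only the first
  \<open>i\<close> elements on \<open>R/A\<close>, which is why \<open>A\<close> admits one regular
  element more than \<open>R/A\<close>.\<close>

lemma wreg_module:
  assumes A: "idl A" and f: "\<And>i. f i \<in> R"
    and "wreg R f A r" "wreg R f {0} (Suc r)"
  shows "wreg A f {0} (Suc r)"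
  unfolding wreg_def
proof (intro allI impI ballI)
  fix i v assume i: "i < Suc r" and v: "v \<in> A" "f i * v \<in> extend_seq A f {0} i"
  have "extend_seq A f {0} i \<subseteq> extend_seq R f {0} i"
    by (rule extend_mono) (use idlD(1)[OF A] in auto)
  then have "v \<in> extend_seq R f {0} i"
    using wregD[OF assms(4) i idlD(1)[OF A v(1)]] v by blast
  then show "v \<in> extend_seq A f {0} i"
    using extend_inter[OF A f] wreg_mono[OF assms(3)] i v by simp
qed

section \<open>Colon ideals, adjoined elements and permutation of regular sequences\<close>

definition adjoin :: "'b set \<Rightarrow> 'b \<Rightarrow> 'b set" where
  "adjoin A x = {a + x * w | a w. a \<in> A \<and> w \<in> R}"

lemma adjoinI: "a \<in> A \<Longrightarrow> w \<in> R \<Longrightarrow> a + x * w \<in> adjoin A x"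
  by (auto simp: adjoin_def)

lemma adjoin_eq_extend: "adjoin A x = extend_seq R (\<lambda>_. x) A 1"
  by (simp add: adjoin_def)

lemma idl_adjoin: "idl A \<Longrightarrow> x \<in> R \<Longrightarrow> idl (adjoin A x)"
  unfolding adjoin_eq_extend by (rule idl_extend) (auto intro: idl_R)

lemma subset_adjoin: "A \<subseteq> adjoin A x"
  unfolding adjoin_eq_extend by (rule subset_extend[OF idl_R])

lemma extend_adjoin:
  assumes A: "idl A" and x: "x \<in> R" and f: "\<And>i. f i \<in> R"
  shows "extend_seq R f (adjoin A x) i = adjoin (extend_seq R f A i) x"
proof -
  have "y \<in> extend_seq R f (adjoin A x) i \<longleftrightarrow> (\<exists>a\<in>A. \<exists>w\<in>R. \<exists>s\<in>extend_seq R f {0} i. y = a + x * w + s)" for y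
    by (subst extend_iff[OF idl_R]) (auto simp: adjoin_def)
  moreover have "y \<in> adjoin (extend_seq R f A i) x \<longleftrightarrow> (\<exists>a\<in>A. \<exists>w\<in>R. \<exists>s\<in>extend_seq R f {0} i. y = a + s + x * w)" for y
    using extend_iff[OF idl_R, of _ f A i] by (auto simp: adjoin_def)
  ultimately show ?thesis by (auto simp: add_ac)
qed

lemma extend_adjoin_split:
  assumes "idl A" and x: "x \<in> R"
    and "s \<in> extend_seq (adjoin A x) f {0} i"
    and f: "\<And>i. f i \<in> R"
  shows "\<exists>a\<in>A. \<exists>t\<in>extend_seq R f {0} i. s = a + x * t"
  using assms(3)
proof (induction i arbitrary: s)
  case 0
  then have "s = 0 + x * 0" by simp
  then show ?case using idlD(2)[OF assms(1)] by fastforce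
next
  case (Suc i)
  then obtain s' y where s: "s = s' + f i * y" "s' \<in> extend_seq (adjoin A x) f {0} i" "y \<in> adjoin A x"
    by auto
  obtain b w where y: "y = b + x * w" "b \<in> A" "w \<in> R" using s(3) by (auto simp: adjoin_def)
  obtain a t where "a \<in> A" "t \<in> extend_seq R f {0} i" "s' = a + x * t" using Suc.IH[OF s(2)] by blast
  moreover from this have "s = (a + f i * b) + x * (t + f i * w)"
    using s y by (simp add: algebra_simps)
  ultimately show ?case
    using y by (intro bexI[of _ "a + f i * b"] bexI[of _ "t + f i * w"]) (auto intro!: idlD[OF assms(1)] f)
qed

text \<open>This is the exact sequence from \<open>R/(A : x)\<close> by multiplication with
  \<open>x\<close> to \<open>R/A\<close> and on to \<open>R/(A + (x))\<close>: regularity on the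
  outer terms passes to the middle one.\<close>

lemma wreg_colon_adjoin:
  assumes A: "idl A" and x: "x \<in> R" and f: "\<And>i. f i \<in> R"
    and colon: "wreg R f {v \<in> R. x * v \<in> A} r" and adj: "wreg R f (adjoin A x) r"
  shows "wreg R f A r"
  unfolding wreg_def
proof (intro allI impI ballI)
  fix i v assume i: "i < r" and v: "v \<in> R" "f i * v \<in> extend_seq R f A i"
  let ?C = "{v \<in> R. x * v \<in> A}" and ?E = "extend_seq R f A i"
  have E: "idl ?E" by (rule idl_extend[OF A idl_R f])
  have E0: "idl (extend_seq R f {0} i)" by (rule idl_extend[OF idl_0 idl_R f])
  \<comment> \<open>Multiplication by \<open>x\<close> stays injective from \<open>R/(A : x)\<close>
    to \<open>R/A\<close> after reduction modulo the first \<open>i\<close> elements, since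
    \<open>extend_inter\<close> makes the relevant Tor of \<open>R/(A + (x))\<close> vanish.\<close>
  have key: "t \<in> extend_seq R f ?C i" if t: "t \<in> R" "x * t \<in> ?E" for t
  proof -
    obtain a s where s: "a \<in> A" "s \<in> extend_seq R f {0} i" "x * t = a + s"
      using t(2) extend_iff[OF idl_R] by blast
    have "s = - a + x * t" using s(3) by simp
    then have "s \<in> adjoin A x" using adjoinI[OF idl_uminus[OF A s(1)] t(1)] by simp
    then have "s \<in> extend_seq (adjoin A x) f {0} i"
      using extend_inter[OF idl_adjoin[OF A x] f wreg_mono[OF adj] s(2)] i by simp
    then obtain b u where u: "b \<in> A" "u \<in> extend_seq R f {0} i" "s = b + x * u"
      using extend_adjoin_split[OF A x, of s f i] f by blast
    have "x * (t - u) = a + b" using s(3) u(3) by (simp add: algebra_simps)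
    moreover have "t - u \<in> R" using idl_diff[OF idl_R t(1) idlD(1)[OF E0 u(2)]] .
    ultimately have "t - u \<in> ?C" using idlD(3)[OF A s(1) u(1)] by simp
    moreover have "t = (t - u) + u" by simp
    ultimately show ?thesis using extend_iff[OF idl_R] u(2) by blast
  qed
  have "?E \<subseteq> extend_seq R f (adjoin A x) i" by (rule extend_mono[OF subset_adjoin]) simp
  then have "v \<in> extend_seq R f (adjoin A x) i" using wregD[OF adj i v(1)] v(2) by blast
  then obtain e t where t: "v = e + x * t" "e \<in> ?E" "t \<in> R"
    unfolding extend_adjoin[OF A x f] by (auto simp: adjoin_def)
  have "x * (f i * t) = f i * v - f i * e" using t(1) by (simp add: algebra_simps)
  then have "x * (f i * t) \<in> ?E" using idl_diff[OF E v(2) idlD(4)[OF E f t(2)]] by simp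
  then have "f i * t \<in> extend_seq R f ?C i" using key mult_closed[OF f t(3)] by blast
  then have "t \<in> extend_seq R f ?C i" using wregD[OF colon i t(3)] by blast
  then obtain c s where c: "c \<in> ?C" "s \<in> extend_seq R f {0} i" "t = c + s"
    using extend_iff[OF idl_R] by blast
  have "x * t = x * c + x * s" using c by (simp add: algebra_simps)
  moreover have "x * c \<in> A" "x * s \<in> extend_seq R f {0} i" using c idlD(4)[OF E0 x] by auto
  ultimately have "x * t \<in> ?E" using extend_iff[OF idl_R] by blast
  then show "v \<in> ?E" using t idlD(3)[OF E] by blast
qed

text \<open>\<open>A\<close> lies in every \<open>extend_seq R f A r\<close>, so \<open>f r\<close>
  may be tested through any \<open>g\<close> congruent to it modulo \<open>A\<close>. Later
  \<open>g\<close> is a monomial standing in for a symmetric polynomial.\<close>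

lemma wreg_cong_extend:
  assumes A: "idl A" and f: "\<And>i. f i \<in> R"
    and "wreg R f A r" and g: "g - f r \<in> A" "g \<in> R"
    and reg: "\<And>v. v \<in> R \<Longrightarrow> g * v \<in> extend_seq R f A r \<Longrightarrow> v \<in> extend_seq R f A r"
  shows "wreg R f A (Suc r)"
  unfolding wreg_def
proof (intro allI impI ballI)
  fix i v assume i: "i < Suc r" and v: "v \<in> R" "f i * v \<in> extend_seq R f A i"
  show "v \<in> extend_seq R f A i"
  proof (cases "i = r")
    case True
    have E: "idl (extend_seq R f A r)" by (rule idl_extend[OF A idl_R f])
    have "g * v = f r * v + (g - f r) * v" by (simp add: algebra_simps)
    moreover have "(g - f r) * v \<in> extend_seq R f A r"
      using subset_extend[OF idl_R] idl_mult_right[OF A v(1) g(1)] by blast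
    ultimately have "g * v \<in> extend_seq R f A r" using v(2) True idlD(3)[OF E] by metis
    then show ?thesis using reg v(1) True by blast
  next
    case False
    then show ?thesis using wregD[OF assms(3) _ v] i by simp
  qed
qed

text \<open>Holds for every homogeneous ideal \<open>A\<close> when \<open>x\<close> is homogeneous of positive degree.\<close>

definition separated :: "'b set \<Rightarrow> 'b \<Rightarrow> bool" where
  "separated A x \<longleftrightarrow> (\<forall>v\<in>R. (\<forall>j. \<exists>a\<in>A. \<exists>w\<in>R. v = a + x ^ j * w) \<longrightarrow> v \<in> A)"

lemma separatedD:
  "separated A x \<Longrightarrow> v \<in> R \<Longrightarrow> (\<And>j. \<exists>a\<in>A. \<exists>w\<in>R. v = a + x ^ j * w) \<Longrightarrow> v \<in> A"
  by (simp add: separated_def)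

text \<open>Exchange of neighbours in the regular sequence \<open>x, f\<close>. If \<open>f\<close>
  kills \<open>v\<close> modulo \<open>A\<close>, then \<open>v = a + x w\<close> where
  \<open>f\<close> kills \<open>w\<close>; iterating puts \<open>v\<close> into every
  \<open>A + (x ^ j)\<close>, hence into \<open>A\<close> by separation. The second conclusion
  follows by division by \<open>x\<close>.\<close>

lemma regular_swap:
  assumes A: "idl A" and x: "x \<in> R" and f: "f \<in> R" and sep: "separated A x"
    and reg_x: "\<And>v. v \<in> R \<Longrightarrow> x * v \<in> A \<Longrightarrow> v \<in> A"
    and reg_f: "\<And>v. v \<in> R \<Longrightarrow> f * v \<in> adjoin A x \<Longrightarrow> v \<in> adjoin A x"
  shows "v \<in> R \<Longrightarrow> f * v \<in> A \<Longrightarrow> v \<in> A"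
    and "v \<in> R \<Longrightarrow> x * v \<in> adjoin A f \<Longrightarrow> v \<in> adjoin A f"
proof -
  have step: "\<exists>a\<in>A. \<exists>w\<in>R. v = a + x * w \<and> f * w \<in> A" if v: "v \<in> R" "f * v \<in> A" for v
  proof -
    obtain a w where w: "v = a + x * w" "a \<in> A" "w \<in> R"
      using reg_f[OF v(1)] v(2) subset_adjoin unfolding adjoin_def by blast
    have "x * (f * w) = f * v - f * a" using w by (simp add: algebra_simps)
    then have "x * (f * w) \<in> A" using idl_diff[OF A v(2) idlD(4)[OF A f w(2)]] by simp
    then have "f * w \<in> A" using reg_x mult_closed[OF f w(3)] by blast
    then show ?thesis using w by blast
  qed
  have reg: "v \<in> A" if v: "v \<in> R" "f * v \<in> A" for v
  proof -
    have "\<exists>a\<in>A. \<exists>w\<in>R. v = a + x ^ j * w \<and> f * w \<in> A" for j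
    proof (induction j)
      case 0
      show ?case using v idlD(2)[OF A] by (intro bexI[of _ 0] bexI[of _ v]) auto
    next
      case (Suc j)
      have pow: "x ^ j \<in> R" by (induction j) (auto intro: one_closed mult_closed x)
      obtain a w where w: "a \<in> A" "w \<in> R" "v = a + x ^ j * w" "f * w \<in> A" using Suc by blast
      obtain b u where u: "b \<in> A" "u \<in> R" "w = b + x * u" "f * u \<in> A" using step[OF w(2,4)] by blast
      have "v = (a + x ^ j * b) + x ^ Suc j * u" using w u by (simp add: algebra_simps)
      moreover have "a + x ^ j * b \<in> A" by (intro idlD(3,4)[OF A] w u pow)
      ultimately show ?case using u by blast
    qed
    then have "\<exists>a\<in>A. \<exists>w\<in>R. v = a + x ^ j * w" for j by blast
    then show ?thesis by (rule separatedD[OF sep v(1)])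
  qed
  show "v \<in> A" if "v \<in> R" "f * v \<in> A" using reg that by blast
  show "v \<in> adjoin A f" if v: "v \<in> R" "x * v \<in> adjoin A f"
  proof -
    obtain a w where w: "x * v = a + f * w" "a \<in> A" "w \<in> R" using v(2) by (auto simp: adjoin_def)
    have "f * w = - a + x * v" using w(1) by simp
    then have "w \<in> adjoin A x" using reg_f[OF w(3)] adjoinI[OF idl_uminus[OF A w(2)] v(1)] by simp
    then obtain b u where u: "w = b + x * u" "b \<in> A" "u \<in> R" by (auto simp: adjoin_def)
    have "x * (v - f * u) = a + f * b" using w u by (simp add: algebra_simps)
    then have "x * (v - f * u) \<in> A" using idlD(3)[OF A w(2) idlD(4)[OF A f u(2)]] by simp
    moreover have "v - f * u \<in> R" using idl_diff[OF idl_R v(1) mult_closed[OF f u(3)]] .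
    ultimately have "v - f * u \<in> A" using reg_x by blast
    from adjoinI[OF this u(3), of f] show ?thesis by simp
  qed
qed

text \<open>Repeated exchange carries \<open>x\<close> from the front of
  \<open>x, f 0, ..., f (r - 1)\<close> to its end.\<close>

lemma wreg_swap:
  assumes A: "idl A" and x: "x \<in> R" and f: "\<And>i. f i \<in> R"
    and sep: "\<And>i. separated (extend_seq R f A i) x"
    and reg_x: "\<And>v. v \<in> R \<Longrightarrow> x * v \<in> A \<Longrightarrow> v \<in> A"
    and "wreg R f (adjoin A x) r"
  shows "wreg R f A r \<and> (\<forall>v\<in>R. x * v \<in> extend_seq R f A r \<longrightarrow> v \<in> extend_seq R f A r)"
  using assms(6)
proof (induction r)
  case 0
  then show ?case using reg_x by (simp add: wreg_def)
next
  case (Suc r)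
  let ?E = "extend_seq R f A r"
  have IH: "wreg R f A r" "\<And>v. v \<in> R \<Longrightarrow> x * v \<in> ?E \<Longrightarrow> v \<in> ?E"
    using Suc.IH wreg_mono[OF Suc.prems, of r] by auto
  have reg_f: "v \<in> adjoin ?E x" if "v \<in> R" "f r * v \<in> adjoin ?E x" for v
    using wregD[OF Suc.prems, of r v] that by (simp add: extend_adjoin[OF A x f])
  have E: "idl ?E" by (rule idl_extend[OF A idl_R f])
  have swap: "v \<in> R \<Longrightarrow> f r * v \<in> ?E \<Longrightarrow> v \<in> ?E" "v \<in> R \<Longrightarrow> x * v \<in> adjoin ?E (f r) \<Longrightarrow> v \<in> adjoin ?E (f r)" for v
    using regular_swap[OF E x f sep IH(2) reg_f] by blast+
  have eq: "extend_seq R f A (Suc r) = adjoin ?E (f r)" by (simp add: adjoin_def)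
  have "f r - f r \<in> A" using idlD(2)[OF A] by simp
  from wreg_cong_extend[OF A f IH(1) this f swap(1)] have "wreg R f A (Suc r)" .
  then show ?case unfolding eq using swap(2) by blast
qed

end

section \<open>The Koszul complex\<close>

text \<open>A Koszul chain \<open>z\<close> is stored by its coefficients, \<open>z S\<close>
  belonging to the basis vector \<open>e_S\<close>. This is the sign in
  \<open>e_j e_S = sg S j e_(insert j S)\<close>, for \<open>j\<close> outside
  \<open>S\<close>.\<close>

definition sg :: "nat set \<Rightarrow> nat \<Rightarrow> 'b::comm_ring_1" where
  "sg S j = (-1) ^ card {i \<in> S. i < j}"

lemma sg_sq: "sg S j * sg S j = 1"
  by (simp add: sg_def flip: power_mult_distrib)

lemma sg_insert:
  assumes "i < j" "i \<notin> S" "finite S"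
  shows "sg (insert j S) i = sg S i" "sg (insert i S) j = - sg S j"
proof -
  have "{a \<in> insert j S. a < i} = {a \<in> S. a < i}" using assms by auto
  then show "sg (insert j S) i = sg S i" unfolding sg_def by simp
  have "{a \<in> insert i S. a < j} = insert i {a \<in> S. a < j}" using assms by auto
  then have "card {a \<in> insert i S. a < j} = Suc (card {a \<in> S. a < j})" using assms by simp
  then show "sg (insert i S) j = - sg S j" unfolding sg_def by simp
qed

text \<open>In coefficients, this is the anticommutativity of \<open>e_i\<close> and
  \<open>e_j\<close>.\<close>

lemma sg_swap:
  assumes "finite S" "i \<notin> S" "j \<notin> S" "i \<noteq> j"
  shows "sg S j * sg (insert j S) i = - (sg S i * sg (insert i S) j)"
proof (cases "i < j")
  case True
  then show ?thesis by (simp add: sg_insert[OF True assms(2,1)] mult.commute)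
next
  case False
  then have "j < i" using assms(4) by simp
  then show ?thesis by (simp add: sg_insert[OF \<open>j < i\<close> assms(3,1)] mult.commute)
qed

text \<open>The Koszul differential read at \<open>S\<close>: the basis vectors whose boundary
  involves \<open>e_S\<close> are those of \<open>insert j S\<close>.\<close>

definition bd :: "nat set \<Rightarrow> (nat \<Rightarrow> 'b::comm_ring_1) \<Rightarrow> (nat set \<Rightarrow> 'b) \<Rightarrow> nat set \<Rightarrow> 'b" where
  "bd V x z S = (\<Sum>j\<in>V - S. sg S j * x j * z (insert j S))"

definition wedge :: "nat \<Rightarrow> (nat set \<Rightarrow> 'b::comm_ring_1) \<Rightarrow> nat set \<Rightarrow> 'b" where
  "wedge l z S = (if l \<in> S then sg (S - {l}) l * z (S - {l}) else 0)"

definition chain :: "nat set \<Rightarrow> 'b::comm_ring_1 set \<Rightarrow> nat \<Rightarrow> (nat set \<Rightarrow> 'b) \<Rightarrow> bool" where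
  "chain V M i z \<longleftrightarrow> (\<forall>S. z S \<in> M \<and> (z S \<noteq> 0 \<longrightarrow> S \<subseteq> V \<and> card S = i))"

lemma chainI: "(\<And>S. z S \<in> M) \<Longrightarrow> (\<And>S. z S \<noteq> 0 \<Longrightarrow> S \<subseteq> V \<and> card S = i) \<Longrightarrow> chain V M i z"
  by (simp add: chain_def)

lemma chain_closed: "chain V M i z \<Longrightarrow> z S \<in> M"
  by (simp add: chain_def)

lemma chain_supp: "chain V M i z \<Longrightarrow> z S \<noteq> 0 \<Longrightarrow> S \<subseteq> V \<and> card S = i"
  by (simp add: chain_def)

lemma bd_add: "bd V x (\<lambda>S. a S + b S) S = bd V x a S + bd V x b S"
  by (simp add: bd_def algebra_simps sum.distrib)

lemma bd_scale: "bd V x (\<lambda>S. c * a S) S = c * bd V x a S"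
  by (simp add: bd_def algebra_simps sum_distrib_left)

lemma bd_sum: "bd V x (\<lambda>S. \<Sum>l\<in>L. a l S) S = (\<Sum>l\<in>L. bd V x (a l) S)"
  by (simp add: bd_def sum_distrib_left) (rule sum.swap)

lemma bd_bd:
  assumes V: "finite V" and S: "finite S"
  shows "bd V x (bd V x z) S = 0"
proof -
  let ?P = "Sigma (V - S) (\<lambda>j. V - insert j S)"
  let ?G = "\<lambda>(j, i). sg S j * sg (insert j S) i * (x j * x i * z (insert i (insert j S)))"
  have "bd V x (bd V x z) S = (\<Sum>j\<in>V - S. \<Sum>i\<in>V - insert j S. ?G (j, i))"
    unfolding bd_def sum_distrib_left by (intro sum.cong refl) (simp add: algebra_simps)
  also have "\<dots> = sum ?G ?P" using V by (subst sum.Sigma) auto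
  also have "\<dots> = 0"
  proof (rule sum_involution_eq_0[where \<iota> = "\<lambda>(j, i). (i, j)" and Q = "\<lambda>(j, i). j < i"])
    fix p assume "p \<in> ?P"
    then obtain j i where p: "p = (j, i)" "i \<notin> S" "j \<notin> S" "i \<noteq> j" by auto
    show "?G (case p of (j, i) \<Rightarrow> (i, j)) = - ?G p"
      using sg_swap[OF S, of i j, where 'a = 'a] p
      by (simp add: insert_commute mult.commute[of "x i"])
  qed (use V in auto)
  finally show ?thesis .
qed

text \<open>Exterior multiplication by \<open>e_l\<close> is a null-homotopy for multiplication by
  \<open>x l\<close>. If \<open>l\<close> is outside \<open>S\<close>, only the index
  \<open>j = l\<close> contributes; otherwise the terms with \<open>j\<close> outside
  \<open>S\<close> cancel between the two summands.\<close>

lemma bd_wedge: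
  fixes z :: "nat set \<Rightarrow> 'b::comm_ring_1"
  assumes V: "finite V" and S: "S \<subseteq> V" and l: "l \<in> V"
  shows "bd V x (wedge l z) S + wedge l (bd V x z) S = x l * z S"
proof (cases "l \<in> S")
  case False
  have "bd V x (wedge l z) S = (\<Sum>j\<in>{l}. sg S j * x j * wedge l z (insert j S))"
    unfolding bd_def using False V l by (intro sum.mono_neutral_right) (auto simp: wedge_def)
  also have "\<dots> = sg S l * sg S l * (x l * z S)"
    using False by (simp add: wedge_def mult_ac)
  finally show ?thesis using False by (simp add: sg_sq wedge_def)
next
  case True
  let ?T = "S - {l}"
  have T: "insert l ?T = S" using True by auto
  have fin: "finite ?T" using finite_subset[OF S V] by simp
  have 1: "sg S j * wedge l z (insert j S) = - (sg ?T l * sg ?T j * z (insert j ?T))" if "j \<in> V - S" for j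
  proof -
    have "insert j S - {l} = insert j ?T" "l \<in> insert j S" using that True by auto
    moreover have "sg S j * sg (insert j ?T) l = - (sg ?T l * sg ?T j :: 'b)"
    proof -
      have "l \<notin> ?T" "j \<notin> ?T" "l \<noteq> j" using that True by auto
      from sg_swap[OF fin this] have "sg ?T j * sg (insert j ?T) l = - (sg ?T l * sg S j :: 'b)"
        unfolding T .
      \<comment> \<open>The previous identity is multiplied by \<open>sg ?T j * sg S j\<close>, and
        squares of signs are removed.\<close>
      moreover have "(sg ?T j * sg ?T j) * (sg S j * sg (insert j ?T) l)
          = sg ?T j * sg S j * (sg ?T j * sg (insert j ?T) l :: 'b)"
        by (simp only: mult_ac)
      moreover have "sg ?T j * sg S j * - (sg ?T l * sg S j)
          = - (sg ?T l * sg ?T j) * (sg S j * sg S j :: 'b)"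
        by (simp only: mult_ac mult_minus_left mult_minus_right)
      ultimately show ?thesis by (simp add: sg_sq)
    qed
    ultimately show ?thesis by (simp add: wedge_def flip: mult.assoc)
  qed
  have "bd V x (wedge l z) S = (\<Sum>j\<in>V - S. x j * (sg S j * wedge l z (insert j S)))"
    unfolding bd_def by (intro sum.cong) (auto simp: mult_ac)
  also have "\<dots> = (\<Sum>j\<in>V - S. - (sg ?T l * (sg ?T j * x j * z (insert j ?T))))"
    by (intro sum.cong refl) (simp add: 1 mult_ac)
  also have "\<dots> = - (sg ?T l * (\<Sum>j\<in>V - S. sg ?T j * x j * z (insert j ?T)))"
    by (simp add: sum_negf sum_distrib_left)
  finally have a: "bd V x (wedge l z) S = \<dots>" .
  have "V - ?T = insert l (V - S)" "l \<notin> V - S" using l True by auto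
  then have "bd V x z ?T = sg ?T l * x l * z S + (\<Sum>j\<in>V - S. sg ?T j * x j * z (insert j ?T))"
    unfolding bd_def using V T by simp
  then have "wedge l (bd V x z) S = sg ?T l * sg ?T l * (x l * z S)
      + sg ?T l * (\<Sum>j\<in>V - S. sg ?T j * x j * z (insert j ?T))"
    using True by (simp add: wedge_def algebra_simps)
  then show ?thesis unfolding a by (simp add: sg_sq)
qed

context subring_carrier
begin

lemma sg_closed: "sg S j \<in> R"
proof -
  have "(-1) ^ k \<in> R" for k by (induction k) (auto intro: one_closed uminus_closed)
  then show ?thesis by (simp add: sg_def)
qed

lemma bd_closed:
  assumes "idl N" "\<And>j. j \<in> V \<Longrightarrow> x j \<in> R" "\<And>S. z S \<in> N"
  shows "bd V x z S \<in> N"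
  unfolding bd_def
  by (rule idl_sum[OF assms(1)]) (auto intro!: idlD(4)[OF assms(1)] mult_closed sg_closed assms)

lemma wedge_closed: "idl N \<Longrightarrow> (\<And>S. z S \<in> N) \<Longrightarrow> wedge l z S \<in> N"
  by (auto simp: wedge_def intro: idlD sg_closed)

lemma chain_bd:
  assumes M: "idl M" and V: "finite V" and x: "\<And>j. j \<in> V \<Longrightarrow> x j \<in> R" and z: "chain V M (Suc i) z"
  shows "chain V M i (bd V x z)"
proof (rule chainI)
  show "bd V x z S \<in> M" for S by (rule bd_closed[OF M x chain_closed[OF z]])
  fix S assume "bd V x z S \<noteq> 0"
  then obtain j where j: "j \<in> V - S" "z (insert j S) \<noteq> 0"
    unfolding bd_def by (metis (no_types, lifting) mult_zero_right sum.neutral)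
  have *: "insert j S \<subseteq> V" "card (insert j S) = Suc i" using chain_supp[OF z j(2)] by auto
  then have "finite S" using finite_subset[OF _ V] by auto
  then show "S \<subseteq> V \<and> card S = i" using * j(1) by simp
qed

lemma chain_wedge:
  assumes M: "idl M" and V: "finite V" and l: "l \<in> V" and z: "chain V M i z"
  shows "chain V M (Suc i) (wedge l z)"
proof (rule chainI)
  show "wedge l z S \<in> M" for S by (rule wedge_closed[OF M chain_closed[OF z]])
  fix S assume "wedge l z S \<noteq> 0"
  then have S: "l \<in> S" "z (S - {l}) \<noteq> 0" by (auto simp: wedge_def split: if_splits)
  have *: "S - {l} \<subseteq> V" "card (S - {l}) = i" using chain_supp[OF z S(2)] by auto
  then have "finite (S - {l})" using finite_subset[OF _ V] by blast
  from card_insert_disjoint[OF this, of l] have "card (insert l (S - {l})) = Suc i" using * by simp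
  then show "S \<subseteq> V \<and> card S = Suc i" using * l S(1) by (auto simp: insert_absorb)
qed

lemma chain_sum_scale:
  assumes M: "idl M" and a: "\<And>l. l \<in> L \<Longrightarrow> a l \<in> R" and z: "\<And>l. l \<in> L \<Longrightarrow> chain V M i (z l)"
  shows "chain V M i (\<lambda>S. \<Sum>l\<in>L. a l * z l S)"
proof (rule chainI)
  show "(\<Sum>l\<in>L. a l * z l S) \<in> M" for S
    by (intro idl_sum[OF M] idlD(4)[OF M] a chain_closed[OF z])
  fix S assume "(\<Sum>l\<in>L. a l * z l S) \<noteq> 0"
  then obtain l where "l \<in> L" "z l S \<noteq> 0" by (metis (no_types, lifting) mult_zero_right sum.neutral)
  then show "S \<subseteq> V \<and> card S = i" using chain_supp[OF z] by blast
qed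

text \<open>A nonzero class in the Koszul homology \<open>H_i(x; M/N)\<close>, represented by a lift
  of a cycle to \<open>M\<close>.\<close>

definition essential :: "nat set \<Rightarrow> (nat \<Rightarrow> 'b) \<Rightarrow> 'b set \<Rightarrow> 'b set \<Rightarrow> nat \<Rightarrow> (nat set \<Rightarrow> 'b) \<Rightarrow> bool" where
  "essential V x M N i z \<longleftrightarrow> chain V M i z \<and> (\<forall>S. bd V x z S \<in> N) \<and>
     \<not> (\<exists>v. chain V M (Suc i) v \<and> (\<forall>S. z S - bd V x v S \<in> N))"

text \<open>
  The connecting map \<open>H\<^sub>i\<^sub>+\<^sub>1(M/(N + gM)) \<rightarrow> H\<^sub>i(M/N)\<close> is onto because \<open>g\<close> annihilates
  Koszul homology; exterior multiplication by the coefficients of \<open>g\<close> provides a preimage.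
\<close>

lemma essential_step:
  assumes M: "idl M" and N: "idl N" and V: "finite V" and x: "\<And>j. j \<in> V \<Longrightarrow> x j \<in> R"
    and a: "\<And>l. l \<in> V \<Longrightarrow> a l \<in> R" and g: "g = (\<Sum>l\<in>V. a l * x l)"
    and reg: "\<And>v. v \<in> M \<Longrightarrow> g * v \<in> N \<Longrightarrow> v \<in> N"
    and z: "essential V x M N i z"
  shows "\<exists>w. essential V x M {y + g * m | y m. y \<in> N \<and> m \<in> M} (Suc i) w"
proof (intro exI)
  \<comment> \<open>Exterior multiplication by the sum of the \<open>a l e_l\<close>. By
    \<open>bd_wedge\<close> it is a null-homotopy for multiplication by \<open>g\<close>.\<close>
  define h where "h u S = (\<Sum>l\<in>V. a l * wedge l u S)" for u S
  let ?N' = "{y + g * m | y m. y \<in> N \<and> m \<in> M}"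
  have gR: "g \<in> R" unfolding g by (intro idl_sum[OF idl_R] mult_closed a x)
  have z': "chain V M i z" "\<And>S. bd V x z S \<in> N"
    and nb: "\<And>v. chain V M (Suc i) v \<Longrightarrow> \<exists>S. z S - bd V x v S \<notin> N"
    using z by (auto simp: essential_def)
  have N': "y + g * m \<in> ?N'" if "y \<in> N" "m \<in> M" for y m using that by blast
  have cb: "chain V M j (bd V x u)" if "chain V M (Suc j) u" for j u
    using x that by (rule chain_bd[OF M V])
  have h_chain: "chain V M (Suc i) (h z)"
    unfolding h_def by (intro chain_sum_scale chain_wedge M V a z') auto
  have hN: "h (bd V x z) S \<in> N" for S
    unfolding h_def by (intro idl_sum[OF N] idlD(4)[OF N] a wedge_closed[OF N] z')
  have bd_h: "bd V x (h z) S = g * z S - h (bd V x z) S" for S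
  proof (cases "S \<subseteq> V")
    case True
    have "bd V x (h z) S + h (bd V x z) S
        = (\<Sum>l\<in>V. a l * (bd V x (wedge l z) S + wedge l (bd V x z) S))"
      unfolding h_def by (simp add: bd_sum bd_scale distrib_left sum.distrib)
    also have "\<dots> = (\<Sum>l\<in>V. a l * (x l * z S))"
      by (intro sum.cong refl) (simp add: bd_wedge[OF V True])
    also have "\<dots> = g * z S" unfolding g by (simp add: sum_distrib_right mult.assoc)
    finally show ?thesis by (simp add: eq_diff_eq)
  next
    case False
    \<comment> \<open>\<open>bd_wedge\<close> covers only subsets of \<open>V\<close>; on all other
      sets every term vanishes.\<close>
    have "bd V x (h z) S = 0" "z S = 0"
      using chain_supp[OF cb[OF h_chain], of S] chain_supp[OF z'(1), of S] False by blast+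
    moreover have "h (bd V x z) S = 0"
    proof -
      have "wedge l (bd V x z) S = 0" if "l \<in> V" for l
      proof -
        have "\<not> insert j (S - {l}) \<subseteq> V" for j using False that by auto
        then have "z (insert j (S - {l})) = 0" for j using chain_supp[OF z'(1)] by blast
        then have "bd V x z (S - {l}) = 0" by (simp add: bd_def)
        then show ?thesis by (simp add: wedge_def)
      qed
      then show ?thesis by (simp add: h_def)
    qed
    ultimately show ?thesis by simp
  qed
  have cyc: "bd V x (h z) S \<in> ?N'" for S
    using N'[OF idl_uminus[OF N hN[of S]] chain_closed[OF z'(1), of S]] unfolding bd_h by simp
  have False if v: "chain V M (Suc (Suc i)) v" "\<And>S. h z S - bd V x v S \<in> ?N'" for v
  proof -
    \<comment> \<open>The two parts are chosen to vanish off the subsets of \<open>V\<close> of size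
      \<open>i + 1\<close>, so that \<open>t\<close> below is itself a chain.\<close>
    have "\<exists>y m. y \<in> N \<and> m \<in> M \<and> h z S - bd V x v S = y + g * m \<and> (m \<noteq> 0 \<or> y \<noteq> 0 \<longrightarrow> S \<subseteq> V \<and> card S = Suc i)" for S
    proof (cases "S \<subseteq> V \<and> card S = Suc i")
      case True
      then show ?thesis using v(2)[of S] by auto
    next
      case False
      then have "h z S = 0" "bd V x v S = 0"
        using chain_supp[OF h_chain, of S] chain_supp[OF cb[OF v(1)], of S] by blast+
      then show ?thesis using idlD(2)[OF N] idlD(2)[OF M] by (intro exI[of _ 0]) auto
    qed
    then obtain y t where yt: "\<And>S. y S \<in> N" "\<And>S. t S \<in> M" "\<And>S. h z S - bd V x v S = y S + g * t S"
      "\<And>S. t S \<noteq> 0 \<or> y S \<noteq> 0 \<longrightarrow> S \<subseteq> V \<and> card S = Suc i" by metis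
    have t: "chain V M (Suc i) t" using yt(2,4) by (blast intro: chainI)
    obtain S where S: "z S - bd V x t S \<notin> N" using nb[OF t] by blast
    have "z S - bd V x t S \<noteq> 0" using S idlD(2)[OF N] by auto
    moreover have bt: "chain V M i (bd V x t)" by (rule cb[OF t])
    ultimately have "S \<subseteq> V" using chain_supp[OF z'(1), of S] chain_supp[OF bt, of S] by fastforce
    then have fS: "finite S" using V finite_subset by blast
    have "h z = (\<lambda>S. bd V x v S + (y S + g * t S))" using yt(3) by (simp add: fun_eq_iff algebra_simps)
    \<comment> \<open>Applying the boundary once more shows that \<open>g\<close> times
      \<open>z - bd V x t\<close> lies in \<open>N\<close> at \<open>S\<close>. As \<open>g\<close>
      is regular modulo \<open>N\<close>, this contradicts the choice of \<open>S\<close>.\<close>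
    then have "bd V x (h z) S = bd V x (bd V x v) S + (bd V x y S + g * bd V x t S)"
      by (simp add: bd_add bd_scale)
    then have "g * (z S - bd V x t S) = h (bd V x z) S + bd V x y S"
      unfolding bd_h bd_bd[OF V fS] by (simp add: algebra_simps)
    also have "\<dots> \<in> N" by (intro idlD(3)[OF N] hN bd_closed[OF N] x yt)
    finally have "g * (z S - bd V x t S) \<in> N" .
    moreover have "z S - bd V x t S \<in> M" by (rule idl_diff[OF M chain_closed[OF z'(1)] chain_closed[OF bt]])
    ultimately show False using reg S by blast
  qed
  then show "essential V x M ?N' (Suc i) (h z)"
    unfolding essential_def using h_chain cyc by blast
qed

text \<open>Each regular element raises the degree of a nonzero class by one, and degree
  \<open>i + r\<close> needs a subset of \<open>V\<close> with that many elements.\<close>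

lemma essential_wreg_length:
  assumes M: "idl M" and V: "finite V" and x: "\<And>j. j \<in> V \<Longrightarrow> x j \<in> R"
    and f: "\<And>i. f i \<in> R" "\<And>i. i < r \<Longrightarrow> \<exists>a. (\<forall>l\<in>V. a l \<in> R) \<and> f i = (\<Sum>l\<in>V. a l * x l)"
    and wreg: "wreg M f {0} r"
    and z: "essential V x M {0} i z"
  shows "i + r \<le> card V"
proof -
  have "\<exists>w. essential V x M (extend_seq M f {0} s) (i + s) w" if "s \<le> r" for s
    using that
  proof (induction s)
    case 0
    then show ?case using z by auto
  next
    case (Suc s)
    then obtain w where w: "essential V x M (extend_seq M f {0} s) (i + s) w" by auto
    obtain a where a: "\<And>l. l \<in> V \<Longrightarrow> a l \<in> R" "f s = (\<Sum>l\<in>V. a l * x l)"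
      using f(2)[of s] Suc.prems by auto
    have sr: "s < r" using Suc.prems by simp
    have N: "idl (extend_seq M f {0} s)" by (rule idl_extend[OF idl_0 M f(1)])
    have "\<exists>w. essential V x M {y + f s * m | y m. y \<in> extend_seq M f {0} s \<and> m \<in> M} (Suc (i + s)) w"
      by (rule essential_step[where a = a, OF M N V]) (fact x a w wregD[OF wreg sr])+
    then show ?case by simp
  qed
  then obtain w where w: "essential V x M (extend_seq M f {0} r) (i + r) w" by blast
  have N: "idl (extend_seq M f {0} r)" by (rule idl_extend[OF idl_0 M f(1)])
  \<comment> \<open>A nonzero class does not agree with the boundary of the zero chain modulo the
    submodule, so \<open>w\<close> has a nonzero value.\<close>
  have "chain V M (Suc (i + r)) (\<lambda>_. 0)" using idlD(2)[OF M] by (simp add: chain_def)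
  moreover have "bd V x (\<lambda>_. 0) S = 0" for S by (simp add: bd_def)
  ultimately obtain S where "w S \<notin> extend_seq M f {0} r" using w unfolding essential_def by force
  then have "w S \<noteq> 0" using idlD(2)[OF N] by auto
  then have "S \<subseteq> V" "card S = i + r" using w by (auto simp: essential_def chain_def)
  then show ?thesis using card_mono[OF V] by metis
qed

end

section \<open>Squarefree monomial ideals\<close>

definition polys :: "nat \<Rightarrow> 'a::field mpol set" where
  "polys n = {p. \<forall>t \<in> Poly_Mapping.keys p. Poly_Mapping.keys t \<subseteq> {1..n}}"

lemma poly_ring_simps [simp]:
  "carrier (poly_ring K n) = polys n" "x \<otimes>\<^bsub>poly_ring K n\<^esub> y = x * y" "\<one>\<^bsub>poly_ring K n\<^esub> = 1"
  "\<zero>\<^bsub>poly_ring K n\<^esub> = 0" "x \<oplus>\<^bsub>poly_ring K n\<^esub> y = x + y"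
  by (auto simp: poly_ring_def polys_def)

interpretation poly: subring_carrier "polys n :: 'a::field mpol set" for n
proof -
  interpret cring "poly_ring TYPE('a) n" by (rule poly_ring_cring)
  show "subring_carrier (polys n :: 'a mpol set)"
  proof
    show "(0 :: 'a mpol) \<in> polys n" using zero_closed by (simp only: poly_ring_simps)
    show "(1 :: 'a mpol) \<in> polys n" using one_closed by (simp only: poly_ring_simps)
    show "a + b \<in> polys n" if "a \<in> polys n" "b \<in> polys n" for a b :: "'a mpol"
      using a_closed[of a b] that by (simp only: poly_ring_simps)
    show "a * b \<in> polys n" if "a \<in> polys n" "b \<in> polys n" for a b :: "'a mpol"
      using m_closed[of a b] that by (simp only: poly_ring_simps)
    show "- a \<in> polys n" if "a \<in> polys n" for a :: "'a mpol"
      using that by (simp add: polys_def)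
  qed
qed

lemma keys_plus: "Poly_Mapping.keys (s + t :: nat \<Rightarrow>\<^sub>0 nat) = Poly_Mapping.keys s \<union> Poly_Mapping.keys t"
  by (auto simp: in_keys_iff lookup_add)

lemma lookup_single_mult:
  fixes p :: "'a::field mpol"
  shows "Poly_Mapping.lookup (Poly_Mapping.single t c * p) (t + u) = c * Poly_Mapping.lookup p u"
  by (simp add: lookup_mult lookup_single when_mult)

lemma keys_single_mult:
  fixes p :: "'a::field mpol"
  assumes "c \<noteq> 0"
  shows "Poly_Mapping.keys (Poly_Mapping.single t c * p) = (+) t ` Poly_Mapping.keys p"
proof
  show "Poly_Mapping.keys (Poly_Mapping.single t c * p) \<subseteq> (+) t ` Poly_Mapping.keys p"
    using keys_mult[of "Poly_Mapping.single t c" p] assms by auto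
  show "(+) t ` Poly_Mapping.keys p \<subseteq> Poly_Mapping.keys (Poly_Mapping.single t c * p)"
    using assms by (auto simp: in_keys_iff lookup_single_mult)
qed

lemma poly_mapping_sum_single:
  "p = (\<Sum>t\<in>Poly_Mapping.keys p. Poly_Mapping.single t (Poly_Mapping.lookup p t))"
  by (rule poly_mapping_eqI) (simp add: lookup_sum lookup_single when_def in_keys_iff sum.delta)

definition sqf :: "nat set \<Rightarrow> nat \<Rightarrow>\<^sub>0 nat" where
  "sqf S = (\<Sum>i\<in>S. Poly_Mapping.single i 1)"

definition sqmon :: "nat set \<Rightarrow> 'a::field mpol" where
  "sqmon S = Poly_Mapping.single (sqf S) 1"

lemma lookup_sqf: "finite S \<Longrightarrow> Poly_Mapping.lookup (sqf S) i = (if i \<in> S then 1 else 0)"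
  by (simp add: sqf_def lookup_sum lookup_single when_def)

lemma keys_sqf: "finite S \<Longrightarrow> Poly_Mapping.keys (sqf S) = S"
  by (auto simp: in_keys_iff lookup_sqf split: if_splits)

lemma sqf_union: "finite S \<Longrightarrow> finite T \<Longrightarrow> S \<inter> T = {} \<Longrightarrow> sqf (S \<union> T) = sqf S + sqf T"
  by (simp add: sqf_def sum.union_disjoint)

lemma sqmon_union: "finite S \<Longrightarrow> finite T \<Longrightarrow> S \<inter> T = {} \<Longrightarrow> sqmon (S \<union> T) = sqmon S * sqmon T"
  by (simp add: sqmon_def sqf_union mult_single)

lemma keys_sqmon [simp]: "Poly_Mapping.keys (sqmon S :: 'a::field mpol) = {sqf S}"
  by (simp add: sqmon_def)

lemma X_eq_sqmon: "X i = sqmon {i}"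
  by (simp add: X_def sqmon_def sqf_def)

lemma prod_X: "finite S \<Longrightarrow> (\<Prod>i\<in>S. X i) = (sqmon S :: 'a::field mpol)"
proof (induction S rule: finite_induct)
  case empty
  then show ?case by (simp add: sqmon_def sqf_def)
next
  case (insert i S)
  then show ?case using sqmon_union[of "{i}" S, where 'a = 'a] by (simp add: X_eq_sqmon)
qed

lemma polys_iff: "p \<in> polys n \<longleftrightarrow> (\<forall>t\<in>Poly_Mapping.keys p. Poly_Mapping.keys t \<subseteq> {1..n})"
  by (simp add: polys_def)

lemma sqmon_closed: "S \<subseteq> {1..n} \<Longrightarrow> sqmon S \<in> polys n"
  by (auto simp: polys_iff keys_sqf finite_subset)

lemma X_closed: "i \<in> {1..n} \<Longrightarrow> X i \<in> polys n"
  by (simp add: X_eq_sqmon sqmon_closed)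

lemma single_eq_sqmon_mult:
  assumes "finite S" "S \<subseteq> Poly_Mapping.keys t"
  shows "Poly_Mapping.single t c = Poly_Mapping.single (t - sqf S) c * sqmon S"
proof -
  have "t - sqf S + sqf S = t"
    using assms by (intro poly_mapping_eqI) (auto simp: lookup_add lookup_minus lookup_sqf in_keys_iff)
  then show ?thesis by (simp add: sqmon_def mult_single)
qed

lemma keys_minus_subset: "Poly_Mapping.keys (s - t :: nat \<Rightarrow>\<^sub>0 nat) \<subseteq> Poly_Mapping.keys s"
  by (auto simp: in_keys_iff lookup_minus)

section \<open>Monomial ideals as upward closed conditions on supports\<close>

definition upward :: "(nat set \<Rightarrow> bool) \<Rightarrow> bool" where
  "upward U \<longleftrightarrow> (\<forall>S T. U S \<longrightarrow> S \<subseteq> T \<longrightarrow> U T)"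

lemma upwardD: "upward U \<Longrightarrow> U S \<Longrightarrow> S \<subseteq> T \<Longrightarrow> U T"
  unfolding upward_def by blast

text \<open>A squarefree monomial ideal is encoded by the condition for a support to belong to a
  monomial of the ideal. Adjoining a variable and taking the colon by it then become Boolean
  operations on \<open>U\<close>.\<close>

definition monideal :: "nat \<Rightarrow> (nat set \<Rightarrow> bool) \<Rightarrow> 'a::field mpol set" where
  "monideal n U = {p \<in> polys n. \<forall>t\<in>Poly_Mapping.keys p. U (Poly_Mapping.keys t)}"

lemma monideal_iff:
  "p \<in> monideal n U \<longleftrightarrow> (\<forall>t\<in>Poly_Mapping.keys p. Poly_Mapping.keys t \<subseteq> {1..n} \<and> U (Poly_Mapping.keys t))"
  by (auto simp: monideal_def polys_iff)

lemma idl_monideal: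
  assumes "upward U" shows "poly.idl n (monideal n U :: 'a::field mpol set)"
  unfolding poly.idl_def
proof (intro conjI ballI)
  show "monideal n U \<subseteq> (polys n :: 'a mpol set)" by (auto simp: monideal_def)
  show "0 \<in> (monideal n U :: 'a mpol set)" by (simp add: monideal_iff)
  show "p + q \<in> monideal n U" if "p \<in> monideal n U" "q \<in> monideal n U" for p q :: "'a mpol"
    using that Poly_Mapping.keys_add[of p q] unfolding monideal_iff by blast
  show "p * q \<in> monideal n U" if pq: "p \<in> polys n" "q \<in> monideal n U" for p q :: "'a mpol"
    unfolding monideal_iff
  proof
    fix t assume "t \<in> Poly_Mapping.keys (p * q)"
    then obtain a b where t: "t = a + b" "a \<in> Poly_Mapping.keys p" "b \<in> Poly_Mapping.keys q"
      using keys_mult[of p q] by blast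
    have a: "Poly_Mapping.keys a \<subseteq> {1..n}" using pq(1) t(2) by (simp only: polys_iff)
    have b: "Poly_Mapping.keys b \<subseteq> {1..n}" "U (Poly_Mapping.keys b)"
      using pq(2) t(3) by (simp_all only: monideal_iff)
    show "Poly_Mapping.keys t \<subseteq> {1..n} \<and> U (Poly_Mapping.keys t)"
      unfolding t(1) keys_plus using a b(1) upwardD[OF assms b(2)] by simp
  qed
qed

lemma monideal_decompose:
  assumes A: "poly.idl n (A :: 'a::field mpol set)" and p: "p \<in> monideal n U"
    and *: "\<And>t c. Poly_Mapping.keys t \<subseteq> {1..n} \<Longrightarrow> U (Poly_Mapping.keys t) \<Longrightarrow> Poly_Mapping.single t c \<in> A"
  shows "p \<in> A"
proof -
  have "(\<Sum>t\<in>Poly_Mapping.keys p. Poly_Mapping.single t (Poly_Mapping.lookup p t)) \<in> A"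
    using p[unfolded monideal_iff] by (intro poly.idl_sum[OF A] *) auto
  then show ?thesis by (simp flip: poly_mapping_sum_single)
qed

lemma upward_disj: "upward U \<Longrightarrow> upward (\<lambda>T. x \<in> T \<or> U T)"
  unfolding upward_def by blast

lemma adjoin_monideal:
  assumes U: "upward U" and x: "x \<in> {1..n}"
  shows "poly.adjoin n (monideal n U :: 'a::field mpol set) (X x) = monideal n (\<lambda>T. x \<in> T \<or> U T)"
proof
  let ?M = "monideal n (\<lambda>T. x \<in> T \<or> U T) :: 'a mpol set"
  have M: "poly.idl n ?M" by (rule idl_monideal[OF upward_disj[OF U]])
  have A: "poly.idl n (poly.adjoin n (monideal n U :: 'a mpol set) (X x))"
    by (rule poly.idl_adjoin[OF idl_monideal[OF U] X_closed[OF x]])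
  have "X x \<in> ?M" using x by (auto simp: monideal_iff X_eq_sqmon keys_sqf)
  then show "poly.adjoin n (monideal n U) (X x) \<subseteq> ?M"
    by (auto simp: poly.adjoin_def monideal_iff[of _ n U] intro!: poly.idlD(3)[OF M] poly.idl_mult_right[OF M])
      (auto simp: monideal_iff)
  show "?M \<subseteq> poly.adjoin n (monideal n U) (X x)"
  proof
    fix p :: "'a mpol" assume "p \<in> ?M"
    then show "p \<in> poly.adjoin n (monideal n U) (X x)"
    proof (rule monideal_decompose[OF A])
      fix t :: "nat \<Rightarrow>\<^sub>0 nat" and c assume t: "Poly_Mapping.keys t \<subseteq> {1..n}" "x \<in> Poly_Mapping.keys t \<or> U (Poly_Mapping.keys t)"
      show "Poly_Mapping.single t (c::'a) \<in> poly.adjoin n (monideal n U) (X x)"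
      proof (cases "U (Poly_Mapping.keys t)")
        case True
        then have "Poly_Mapping.single t c \<in> monideal n U" using t by (auto simp: monideal_iff)
        then show ?thesis using poly.subset_adjoin by blast
      next
        case False
        then have "Poly_Mapping.single t c = Poly_Mapping.single (t - sqf {x}) c * X x"
          using t(2) by (simp add: X_eq_sqmon single_eq_sqmon_mult[of "{x}"])
        also have "\<dots> = 0 + X x * Poly_Mapping.single (t - sqf {x}) c" by (simp add: mult.commute)
        also have "\<dots> \<in> poly.adjoin n (monideal n U) (X x)"
          using t(1) keys_minus_subset[of t "sqf {x}"]
          by (intro poly.adjoinI) (auto simp: monideal_iff polys_iff)
        finally show ?thesis .
      qed
    qed
  qed
qed

text \<open>Multiplication by \<open>X x\<close> shifts all exponents injectively, so no terms
  cancel and membership can be read off term by term.\<close>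

lemma colon_monideal:
  assumes x: "x \<in> {1..n}"
  shows "{v \<in> polys n. X x * v \<in> monideal n U} = (monideal n (\<lambda>T. U (insert x T)) :: 'a::field mpol set)"
proof -
  have "Poly_Mapping.keys (X x * v) = (+) (sqf {x}) ` Poly_Mapping.keys v" for v :: "'a mpol"
    by (simp add: X_eq_sqmon sqmon_def keys_single_mult)
  then have "X x * v \<in> monideal n U \<longleftrightarrow>
      (\<forall>t\<in>Poly_Mapping.keys v. insert x (Poly_Mapping.keys t) \<subseteq> {1..n} \<and> U (insert x (Poly_Mapping.keys t)))"
    for v :: "'a mpol"
    by (simp add: monideal_iff keys_plus keys_sqf)
  then show ?thesis unfolding monideal_iff[of _ n "\<lambda>T. U (insert x T)"] polys_iff set_eq_iff
    using x by blast
qed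

lemma ideal_idl:
  assumes A: "poly.idl n (A :: 'a::field mpol set)"
  shows "ideal A (poly_ring K n)"
proof -
  interpret cring "poly_ring K n" by (rule poly_ring_cring)
  have neg: "\<ominus>\<^bsub>poly_ring K n\<^esub> x = - x" if "x \<in> polys n" for x :: "'a mpol"
    by (rule minus_equality) (use that poly.uminus_closed in auto)
  show ?thesis
  proof (rule idealI[OF ring_axioms])
    show "subgroup A (add_monoid (poly_ring K n))"
    proof (rule subgroup.intro)
      fix x assume "x \<in> A"
      then have "\<ominus>\<^bsub>poly_ring K n\<^esub> x \<in> A"
        using neg[OF poly.idlD(1)[OF A]] poly.idl_uminus[OF A] by simp
      then show "inv\<^bsub>add_monoid (poly_ring K n)\<^esub> x \<in> A" by (simp add: a_inv_def)
    qed (use poly.idlD[OF A] in auto)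
  qed (use poly.idlD(4)[OF A] poly.idl_mult_right[OF A] in auto)
qed

lemma genideal_mon:
  assumes E: "\<And>E. E \<in> \<E> \<Longrightarrow> E \<subseteq> {1..n}"
  shows "Idl\<^bsub>poly_ring K n\<^esub> (sqmon ` \<E>) = (monideal n (\<lambda>T. \<exists>E\<in>\<E>. E \<subseteq> T) :: 'a::field mpol set)"
proof
  interpret cring "poly_ring K n" by (rule poly_ring_cring)
  have fin: "finite E" if "E \<in> \<E>" for E using E[OF that] finite_subset by blast
  let ?M = "monideal n (\<lambda>T. \<exists>E\<in>\<E>. E \<subseteq> T) :: 'a mpol set"
  have M: "poly.idl n ?M" by (rule idl_monideal) (auto simp: upward_def)
  show "Idl\<^bsub>poly_ring K n\<^esub> (sqmon ` \<E>) \<subseteq> ?M"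
    by (rule genideal_minimal[OF ideal_idl[OF M]]) (use E fin in \<open>fastforce simp: monideal_iff keys_sqf\<close>)
  have gen: "sqmon ` \<E> \<subseteq> carrier (poly_ring K n)"
    unfolding poly_ring_simps by (intro image_subsetI sqmon_closed E)
  interpret I: ideal "Idl\<^bsub>poly_ring K n\<^esub> (sqmon ` \<E>)" "poly_ring K n" by (rule genideal_ideal[OF gen])
  have Idl: "poly.idl n (Idl\<^bsub>poly_ring K n\<^esub> (sqmon ` \<E>))"
    unfolding poly.idl_def using I.a_subset I.zero_closed I.a_closed I.I_l_closed by auto
  have "p \<in> Idl\<^bsub>poly_ring K n\<^esub> (sqmon ` \<E>)" if "p \<in> ?M" for p
    using Idl that
  proof (rule monideal_decompose)
    fix t :: "nat \<Rightarrow>\<^sub>0 nat" and c :: 'a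
    assume t: "Poly_Mapping.keys t \<subseteq> {1..n}" "\<exists>E\<in>\<E>. E \<subseteq> Poly_Mapping.keys t"
    then obtain S where S: "S \<in> \<E>" "S \<subseteq> Poly_Mapping.keys t" by blast
    have "sqmon S \<in> Idl\<^bsub>poly_ring K n\<^esub> (sqmon ` \<E>)" using genideal_self[OF gen] S by blast
    moreover have "Poly_Mapping.single (t - sqf S) c \<in> polys n"
      using subset_trans[OF keys_minus_subset t(1)] by (simp add: polys_iff)
    ultimately show "Poly_Mapping.single t c \<in> Idl\<^bsub>poly_ring K n\<^esub> (sqmon ` \<E>)"
      using I.I_l_closed by (simp add: single_eq_sqmon_mult[OF fin[OF S(1)] S(2)])
  qed
  then show "?M \<subseteq> Idl\<^bsub>poly_ring K n\<^esub> (sqmon ` \<E>)" by blast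
qed

section \<open>Elementary symmetric polynomials\<close>

definition deg :: "nat \<Rightarrow> (nat \<Rightarrow>\<^sub>0 nat) \<Rightarrow> nat" where
  "deg n t = (\<Sum>i\<in>{1..n}. Poly_Mapping.lookup t i)"

lemma deg_add: "deg n (s + t) = deg n s + deg n t"
  by (simp add: deg_def lookup_add sum.distrib)

lemma deg_sqf: "S \<subseteq> {1..n} \<Longrightarrow> deg n (sqf S) = card S"
  using finite_subset[of S "{1..n}"] by (simp add: deg_def lookup_sqf sum.If_cases Int_absorb1)

definition homog :: "nat \<Rightarrow> nat \<Rightarrow> 'a::field mpol \<Rightarrow> bool" where
  "homog n d p \<longleftrightarrow> (\<forall>t\<in>Poly_Mapping.keys p. deg n t = d)"

definition trunc :: "nat \<Rightarrow> nat \<Rightarrow> 'a::field mpol \<Rightarrow> 'a mpol" where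
  "trunc n j p = Poly_Mapping.mapp (\<lambda>t c. if deg n t < j then c else 0) p"

lemma lookup_trunc:
  "Poly_Mapping.lookup (trunc n j p) t = (if deg n t < j then Poly_Mapping.lookup p t else 0)"
  by (simp add: trunc_def Poly_Mapping.lookup_mapp when_def in_keys_iff)

lemma keys_trunc: "Poly_Mapping.keys (trunc n j p) \<subseteq> Poly_Mapping.keys p"
  by (auto simp: in_keys_iff lookup_trunc split: if_splits)

lemma trunc_add: "trunc n j (p + q) = trunc n j p + trunc n j q"
  by (rule poly_mapping_eqI) (simp add: lookup_trunc lookup_add)

lemma trunc_0: "trunc n 0 p = 0"
  by (rule poly_mapping_eqI) (simp add: lookup_trunc)

text \<open>Every term of \<open>f\<close> contributes degree \<open>d\<close>. For
  \<open>j \<le> d\<close> the natural subtraction gives \<open>trunc n 0\<close>, which is zero, as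
  it should be.\<close>

lemma trunc_homog_mult:
  assumes "homog n d f"
  shows "trunc n j (f * p) = f * trunc n (j - d) p"
proof (rule poly_mapping_eqI)
  fix t
  let ?L = Poly_Mapping.lookup
  have "?L f l * Sum_any (\<lambda>q. ?L (trunc n (j - d) p) q when t = l + q)
      = (if deg n t < j then ?L f l * Sum_any (\<lambda>q. ?L p q when t = l + q) else 0)" for l
  proof (cases "l \<in> Poly_Mapping.keys f")
    case True
    then have "deg n l = d" using assms by (simp add: homog_def)
    then have "(?L (trunc n (j - d) p) q when t = l + q) = (if deg n t < j then (?L p q when t = l + q) else 0)" for q
      by (auto simp: lookup_trunc when_def deg_add)
    then show ?thesis by simp
  qed (simp add: in_keys_iff)
  then show "?L (trunc n j (f * p)) t = ?L (f * trunc n (j - d) p) t"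
    by (simp add: lookup_trunc lookup_mult)
qed

lemma homog_power:
  assumes "homog n d f" shows "homog n (j * d) (f ^ j)"
proof (induction j)
  case 0
  then show ?case by (simp add: homog_def deg_def)
next
  case (Suc j)
  then show ?case using assms keys_mult[of f "f ^ j"] by (fastforce simp: homog_def deg_add)
qed

text \<open>For an additive subgroup this amounts to homogeneity, since a homogeneous component is
  the difference of two truncations.\<close>

definition graded :: "nat \<Rightarrow> 'a::field mpol set \<Rightarrow> bool" where
  "graded n A \<longleftrightarrow> (\<forall>v\<in>A. \<forall>j. trunc n j v \<in> A)"

lemma graded_monideal: "graded n (monideal n U)"
  unfolding graded_def
proof (intro ballI allI)
  fix v j assume "v \<in> monideal n U"
  then show "trunc n j v \<in> monideal n U" unfolding monideal_iff using keys_trunc by blast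
qed

lemma graded_extend_seq:
  assumes "graded n A" "graded n M" "\<And>i. homog n (d i) (f i)"
  shows "graded n (extend_seq M f A i)"
proof (induction i)
  case 0
  then show ?case using assms(1) by simp
next
  case (Suc i)
  show ?case unfolding graded_def
  proof (intro ballI allI)
    fix v j assume "v \<in> extend_seq M f A (Suc i)"
    then obtain a w where v: "v = a + f i * w" "a \<in> extend_seq M f A i" "w \<in> M" by auto
    have "trunc n j v = trunc n j a + f i * trunc n (j - d i) w"
      by (simp add: v(1) trunc_add trunc_homog_mult[OF assms(3)])
    then show "trunc n j v \<in> extend_seq M f A (Suc i)"
      using extend_SucI[of "trunc n j a" M f A i] Suc assms(2) v(2,3) unfolding graded_def by metis
  qed
qed

text \<open>Choose \<open>j\<close> above all degrees in \<open>v\<close>. The multiple of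
  \<open>x ^ j\<close> has no terms below degree \<open>j\<close>, so \<open>v\<close> is the
  truncation of an element of \<open>A\<close>.\<close>

lemma separated_graded:
  assumes A: "graded n (A :: 'a::field mpol set)" and x: "homog n d x" "d > 0"
  shows "poly.separated n A x"
  unfolding poly.separated_def
proof (intro ballI impI)
  fix v :: "'a mpol" assume "v \<in> polys n" and *: "\<forall>j. \<exists>a\<in>A. \<exists>w\<in>polys n. v = a + x ^ j * w"
  \<comment> \<open>The added \<open>0\<close> keeps the maximum defined when
    \<open>v = 0\<close>.\<close>
  define j where "j = Suc (Max (insert 0 (deg n ` Poly_Mapping.keys v)))"
  have "deg n t < j" if "t \<in> Poly_Mapping.keys v" for t
    using that unfolding j_def less_Suc_eq_le by (intro Max_ge) auto
  then have v: "trunc n j v = v"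
    by (intro poly_mapping_eqI) (metis in_keys_iff lookup_trunc)
  obtain a w where w: "a \<in> A" "v = a + x ^ j * w" using * by blast
  have "j \<le> j * d" using x(2) by simp
  then have "trunc n j (x ^ j * w) = 0"
    by (simp add: trunc_homog_mult[OF homog_power[OF x(1)]] trunc_0)
  then have "trunc n j v = trunc n j a" by (simp add: w(2) trunc_add)
  then show "v \<in> A" using v w(1) A unfolding graded_def by metis
qed

definition esym :: "nat \<Rightarrow> nat \<Rightarrow> 'a::field mpol" where
  "esym n i = (\<Sum>S | S \<subseteq> {1..n} \<and> card S = i. sqmon S)"

lemma keys_esym:
  assumes "t \<in> Poly_Mapping.keys (esym n i :: 'a::field mpol)"
  obtains S where "t = sqf S" "S \<subseteq> {1..n}" "card S = i"
proof -
  have "Poly_Mapping.lookup (esym n i :: 'a mpol) t \<noteq> 0" using assms by (simp add: in_keys_iff)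
  then obtain S where "S \<subseteq> {1..n}" "card S = i" "Poly_Mapping.lookup (sqmon S :: 'a mpol) t \<noteq> 0"
    unfolding esym_def lookup_sum by (metis (mono_tags, lifting) mem_Collect_eq sum.neutral)
  then show thesis by (intro that) (auto simp: sqmon_def lookup_single when_def split: if_splits)
qed

lemma esym_closed: "esym n i \<in> polys n"
  unfolding polys_iff
proof
  fix t assume "t \<in> Poly_Mapping.keys (esym n i :: 'a::field mpol)"
  then obtain S where "t = sqf S" "S \<subseteq> {1..n}" by (rule keys_esym)
  then show "Poly_Mapping.keys t \<subseteq> {1..n}" using keys_sqf[of S] finite_subset by fastforce
qed

lemma homog_esym: "homog n i (esym n i)"
  unfolding homog_def by (metis keys_esym deg_sqf)

text \<open>Exactly one squarefree monomial of degree \<open>n - card C\<close> avoids the variables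
  in \<open>C\<close>, namely the product of all the others.\<close>

lemma esym_minus_sqmon:
  assumes C: "C \<subseteq> {1..n}" and N: "N = n - card C"
  shows "sqmon ({1..n} - C) - esym n N \<in> (monideal n (\<lambda>T. T \<inter> C \<noteq> {}) :: 'a::field mpol set)"
proof -
  let ?F = "{S. S \<subseteq> {1..n} \<and> card S = N}" and ?D = "{1..n} - C"
  have finC: "finite C" using C finite_subset by blast
  have D: "?D \<in> ?F" using C finC N by (simp add: card_Diff_subset)
  have fin: "finite ?F" by simp
  let ?M = "monideal n (\<lambda>T. T \<inter> C \<noteq> {}) :: 'a mpol set"
  have M: "poly.idl n ?M" by (rule idl_monideal) (auto simp: upward_def)
  have "esym n N = sqmon ?D + (\<Sum>S\<in>?F - {?D}. sqmon S :: 'a mpol)"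
    unfolding esym_def using fin D by (rule sum.remove)
  then have "sqmon ?D - esym n N = - (\<Sum>S\<in>?F - {?D}. sqmon S :: 'a mpol)" by simp
  also have "\<dots> \<in> ?M"
  proof (intro poly.idl_uminus[OF M] poly.idl_sum[OF M])
    fix S assume S: "S \<in> ?F - {?D}"
    then have "finite S" using finite_subset by blast
    moreover have "S \<inter> C \<noteq> {}"
    proof
      assume "S \<inter> C = {}"
      then have "S \<subseteq> ?D" using S by auto
      then have "S = ?D" using S D by (intro card_subset_eq) auto
      then show False using S by simp
    qed
    ultimately show "sqmon S \<in> ?M" using S by (simp add: monideal_iff keys_sqf)
  qed
  finally show ?thesis .
qed

text \<open>Let \<open>N + 1 = n - card C\<close>. For any variable \<open>x\<close> outside
  \<open>C\<close>, the induction hypothesis for \<open>insert x C\<close> and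
  \<open>wreg_swap\<close> give that the first \<open>N\<close> symmetric polynomials followed by
  \<open>x\<close> are regular. Hence the product of all variables outside \<open>C\<close> is
  regular after these \<open>N\<close>, and modulo \<open>C\<close> it is the next symmetric
  polynomial.\<close>

lemma wreg_esym_prime:
  assumes "C \<subseteq> {1..n}"
  shows "wreg (polys n) (\<lambda>i. esym n (Suc i)) (monideal n (\<lambda>T. T \<inter> C \<noteq> {}) :: 'a::field mpol set) (n - card C)"
  using assms
proof (induction "n - card C" arbitrary: C)
  case 0
  then show ?case by (simp add: wreg_def)
next
  case (Suc N)
  let ?f = "\<lambda>i. esym n (Suc i) :: 'a mpol" and ?D = "{1..n} - C"
  let ?A = "monideal n (\<lambda>T. T \<inter> C \<noteq> {}) :: 'a mpol set"
  have up: "upward (\<lambda>T. T \<inter> C \<noteq> {})" by (auto simp: upward_def)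
  have A: "poly.idl n ?A" by (rule idl_monideal[OF up])
  have f: "?f i \<in> polys n" for i by (rule esym_closed)
  have finC: "finite C" using Suc.prems finite_subset by blast
  have "graded n (polys n :: 'a mpol set)"
    using graded_monideal[of n "\<lambda>_. True"] by (simp add: monideal_def)
  then have grad: "graded n (extend_seq (polys n) ?f ?A i)" for i
    by (rule graded_extend_seq[OF graded_monideal, where d = Suc]) (rule homog_esym)
  have swap: "wreg (polys n) ?f ?A N \<and> (\<forall>v\<in>polys n. X x * v \<in> extend_seq (polys n) ?f ?A N \<longrightarrow> v \<in> extend_seq (polys n) ?f ?A N)"
    if x: "x \<in> ?D" for x
  proof (rule poly.wreg_swap[OF A X_closed f])
    show "x \<in> {1..n}" using x by simp
    have "homog n 1 (X x :: 'a mpol)" using x by (simp add: homog_def X_eq_sqmon deg_sqf)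
    then show "poly.separated n (extend_seq (polys n) ?f ?A i) (X x)" for i
      by (rule separated_graded[OF grad]) simp
    show "v \<in> ?A" if "v \<in> polys n" "X x * v \<in> ?A" for v
      using that x colon_monideal[of x n "\<lambda>T. T \<inter> C \<noteq> {}"] by auto
    have "N = n - card (insert x C)" using Suc.hyps(2) x finC by simp
    moreover have "poly.adjoin n ?A (X x) = monideal n (\<lambda>T. T \<inter> insert x C \<noteq> {})"
      using x by (subst adjoin_monideal[OF up]) (auto intro!: arg_cong[where f = "monideal n"])
    ultimately show "wreg (polys n) ?f (poly.adjoin n ?A (X x)) N"
      using Suc.hyps(1)[of "insert x C"] Suc.prems x by auto
  qed
  \<comment> \<open>Some variable outside \<open>C\<close> must exist before \<open>swap\<close>
    yields regularity of the first \<open>N\<close> elements.\<close>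
  have "card C < card {1..n}" using Suc.hyps(2) by simp
  then have "?D \<noteq> {}" using finC card_mono[of C "{1..n}"] by auto
  then have reg: "wreg (polys n) ?f ?A N" using swap by blast
  have "v \<in> extend_seq (polys n) ?f ?A N"
    if "finite S" "S \<subseteq> ?D" "v \<in> polys n" "(\<Prod>i\<in>S. X i) * v \<in> extend_seq (polys n) ?f ?A N" for S v
    using that
  proof (induction S arbitrary: v rule: finite_induct)
    case (insert x S)
    have "X x * v \<in> polys n" using insert.prems by (intro poly.mult_closed X_closed) auto
    moreover have "(\<Prod>i\<in>S. X i) * (X x * v) \<in> extend_seq (polys n) ?f ?A N"
      using insert.prems(3) insert.hyps by (simp add: mult_ac)
    ultimately have "X x * v \<in> extend_seq (polys n) ?f ?A N" using insert by simp
    then show ?case using swap insert.prems by blast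
  qed simp
  then have regD: "v \<in> extend_seq (polys n) ?f ?A N"
    if "v \<in> polys n" "sqmon ?D * v \<in> extend_seq (polys n) ?f ?A N" for v
    using that prod_X[of ?D] by (metis finite_Diff finite_atLeastAtMost order_refl)
  have "wreg (polys n) ?f ?A (Suc N)"
  proof (rule poly.wreg_cong_extend[OF A f reg])
    show "sqmon ?D - ?f N \<in> ?A" using esym_minus_sqmon[OF Suc.prems Suc.hyps(2)] .
  qed (use regD in \<open>auto intro: sqmon_closed\<close>)
  then show ?case using Suc.hyps(2) by simp
qed

section \<open>Regular sequences modulo the path ideal\<close>

definition edge :: "nat \<Rightarrow> nat \<Rightarrow> nat \<Rightarrow> nat set" where
  "edge d m i = {(i - 1) * d + 1..(i - 1) * d + m}"

lemma wreg_esym_step: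
  assumes U: "upward U" and x: "x \<in> {1..n}"
    and "wreg (polys n) (\<lambda>i. esym n (Suc i)) (monideal n (\<lambda>T. U (insert x T)) :: 'a::field mpol set) r"
    and "wreg (polys n) (\<lambda>i. esym n (Suc i)) (monideal n (\<lambda>T. x \<in> T \<or> U T) :: 'a mpol set) r"
  shows "wreg (polys n) (\<lambda>i. esym n (Suc i)) (monideal n U :: 'a mpol set) r"
  by (rule poly.wreg_colon_adjoin[OF idl_monideal[OF U] X_closed[OF x] esym_closed])
    (use assms in \<open>simp_all only: colon_monideal adjoin_monideal\<close>)

text \<open>The quotient is zero here. This closes the branch in which all variables of an edge have
  been removed.\<close>

lemma wreg_monideal_top:
  assumes "\<And>T. U T"
  shows "wreg (polys n) f (monideal n U :: 'a::field mpol set) r"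
proof -
  have "monideal n U = (polys n :: 'a mpol set)" using assms by (auto simp: monideal_def)
  moreover have "polys n \<subseteq> extend_seq (polys n) f (polys n :: 'a mpol set) i" for i
    by (rule poly.subset_extend[OF poly.idl_R])
  ultimately show ?thesis unfolding wreg_def by auto
qed

text \<open>The condition for the ideal generated by the variables in \<open>C\<close> and the
  monomials of \<open>E i - W\<close>, \<open>i\<close> in \<open>I\<close>. Adjoined variables
  enter \<open>C\<close>; variables by which a colon was taken enter \<open>W\<close>.\<close>

definition fam :: "(nat \<Rightarrow> nat set) \<Rightarrow> nat set \<Rightarrow> nat set \<Rightarrow> nat set \<Rightarrow> nat set \<Rightarrow> bool" where
  "fam E C W I T \<longleftrightarrow> T \<inter> C \<noteq> {} \<or> (\<exists>i\<in>I. E i \<subseteq> T \<union> W)"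

lemma upward_fam: "upward (fam E C W I)"
  unfolding upward_def fam_def by blast

lemma fam_insert:
  assumes "x \<notin> C"
  shows "(\<lambda>T. fam E C W I (insert x T)) = fam E C (insert x W) I"
  using assms by (auto simp: fam_def fun_eq_iff)

lemma fam_disj:
  assumes "x \<notin> W" "I' \<subseteq> I" "\<And>i. i \<in> I - I' \<Longrightarrow> x \<in> E i"
  shows "(\<lambda>T. x \<in> T \<or> fam E C W I T) = fam E (insert x C) W I'"
proof
  fix T
  show "(x \<in> T \<or> fam E C W I T) = fam E (insert x C) W I' T"
  proof (cases "x \<in> T")
    case True
    then show ?thesis by (auto simp: fam_def)
  next
    case False
    then have "i \<in> I'" if "i \<in> I" "E i \<subseteq> T \<union> W" for i using that assms by blast
    then show ?thesis using False assms(2) by (auto simp: fam_def)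
  qed
qed

text \<open>A guarantee that \<open>j\<close> more adjoined variables hit the edges
  \<open>c, ..., k\<close>: one variable moves the first unhit edge to at least
  \<open>max (c + 1) e\<close>, two move it by at least \<open>q + 1\<close>. For odd
  \<open>j\<close> the unpaired variable is spent first.\<close>

definition budget :: "nat \<Rightarrow> nat \<Rightarrow> nat \<Rightarrow> nat \<Rightarrow> nat \<Rightarrow> bool" where
  "budget q k j c e \<longleftrightarrow>
    (if even j then k < c + j div 2 * (q + 1) else k < max (c + 1) e + j div 2 * (q + 1))"

text \<open>For odd \<open>Suc j\<close> the present bound \<open>e\<close> is used up; for even
  \<open>Suc j\<close> the promised advance of \<open>q + 1\<close> from \<open>c\<close> is handed
  on as the new \<open>e\<close>.\<close>

lemma budget_step:
  assumes "budget q k (Suc j) c e" "max (c + 1) e \<le> c'"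
  shows "budget q k j c' (c + q + 1)"
proof (cases "even j")
  case True
  then show ?thesis using assms by (auto simp: budget_def)
next
  case False
  then have "Suc j div 2 = Suc (j div 2)" by presburger
  then show ?thesis using assms False by (auto simp: budget_def)
qed

text \<open>
  The edges \<open>c, \<dots>, k\<close> have not been hit by \<open>C\<close>; the variables in \<open>W\<close> have been removed
  from them, which only affects the edges before \<open>e\<close> and makes the edge \<open>c\<close> the smallest of these.
  Adding the variable \<open>x\<close> of the edge \<open>c\<close>, after all later ones have been removed, hits all
  edges before some \<open>c' \<ge> max (c + 1) e\<close>.
\<close>

lemma wreg_esym_fam:
  fixes d q s k n m :: nat
  assumes m: "m = q * d + s" and s: "s < d" and n: "(k - 1) * d + m \<le> n"
  defines "E \<equiv> edge d m"
  assumes "budget q k j c e" "1 \<le> c" "e \<le> c + q + 1" "C \<subseteq> {1..n}" "W \<subseteq> {1..n}" "card C + j \<le> b"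
    and "\<And>i. e \<le> i \<Longrightarrow> i \<le> k \<Longrightarrow> E i \<inter> W = {}"
    and "\<And>i. c \<le> i \<Longrightarrow> i < e \<Longrightarrow> i \<le> k \<Longrightarrow> E c - W \<subseteq> E i"
    and "\<And>i. c \<le> i \<Longrightarrow> i \<le> k \<Longrightarrow> E i \<inter> C = {}"
  shows "wreg (polys n) (\<lambda>i. esym n (Suc i)) (monideal n (fam E C W {c..k}) :: 'a::field mpol set) (n - b)"
  using assms(5-)
proof (induction j arbitrary: c e C W)
  case base: 0
  then have "{c..k} = {}" by (simp add: budget_def)
  then have "fam E C W {c..k} = (\<lambda>T. T \<inter> C \<noteq> {})" by (simp add: fam_def fun_eq_iff)
  moreover have "n - b \<le> n - card C" using base(6) by simp
  ultimately show ?case using wreg_mono[OF wreg_esym_prime[OF base(4)]] by simp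
next
  case (Suc j)
  note IH = Suc.IH and prems = Suc.prems
  note early = prems(8) and unhit = prems(9)
  let ?P = "\<lambda>U. wreg (polys n) (\<lambda>i. esym n (Suc i)) (monideal n U :: 'a mpol set) (n - b)"
  have mem: "y \<in> E i \<longleftrightarrow> (i - 1) * d < y \<and> y \<le> (i - 1) * d + m" for y i
    by (auto simp: E_def edge_def)
  have mono: "(i - 1) * d \<le> (i' - 1) * d" if "i \<le> i'" for i i' using that by (intro mult_le_mono1) simp
  show ?case
  proof (cases "c \<le> k")
    case False
    then have "fam E C W {c..k} = (\<lambda>T. T \<inter> C \<noteq> {})" by (simp add: fam_def fun_eq_iff)
    moreover have "n - b \<le> n - card C" using prems(6) by simp
    ultimately show ?thesis using wreg_mono[OF wreg_esym_prime[OF prems(4)]] by simp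
  next
    case ck: True
    have Ec: "E c \<subseteq> {1..n}"
    proof
      fix y assume "y \<in> E c"
      then show "y \<in> {1..n}" using mono[OF ck] n unfolding mem atLeastAtMost_iff by linarith
    qed
    \<comment> \<open>\<open>V\<close> collects the variables of edge \<open>c\<close> already
      removed. Being a final segment of \<open>E c - W\<close>, it records that the splitting
      proceeds in decreasing order.\<close>
    have "?P (fam E C (W \<union> V) {c..k})"
      if "V \<subseteq> E c" "\<forall>v\<in>V. \<forall>y\<in>E c - (W \<union> V). y < v" for V
      using that
    proof (induction "card (E c - (W \<union> V))" arbitrary: V)
      case 0
      have "finite (E c)" by (simp add: E_def edge_def)
      then have "E c \<subseteq> W \<union> V" using 0(1) by auto
      then have "fam E C (W \<union> V) {c..k} T" for T using ck by (fastforce simp: fam_def)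
      then show ?case by (rule wreg_monideal_top)
    next
      case inner: (Suc r)
      have V: "V \<subseteq> E c" by (rule inner.prems(1))
      have fin: "finite (E c - (W \<union> V))" by (simp add: E_def edge_def)
      define x where "x = Max (E c - (W \<union> V))"
      have "E c - (W \<union> V) \<noteq> {}" using inner.hyps(2) card_gt_0_iff[of "E c - (W \<union> V)"] by linarith
      then have x: "x \<in> E c" "x \<notin> W" "x \<notin> V" and xmax: "\<And>y. y \<in> E c \<Longrightarrow> y \<notin> W \<Longrightarrow> y \<notin> V \<Longrightarrow> y \<le> x"
        using Max_in[OF fin] Max_ge[OF fin] unfolding x_def by auto
      have xC: "x \<notin> C" using x(1) unhit[OF order_refl ck] by blast
      have xn: "x \<in> {1..n}" using x(1) Ec by blast
      show ?case
      proof (rule wreg_esym_step[OF upward_fam xn])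
        have "E c - (W \<union> insert x V) = E c - (W \<union> V) - {x}" by auto
        then have "r = card (E c - (W \<union> insert x V))" using inner.hyps(2) fin x by simp
        moreover have "\<forall>v\<in>insert x V. \<forall>y\<in>E c - (W \<union> insert x V). y < v"
          using inner.prems(2) xmax by (auto simp: order.strict_iff_order)
        ultimately have "?P (fam E C (W \<union> insert x V) {c..k})" using inner.hyps(1) V x(1) by blast
        then show "?P (\<lambda>T. fam E C (W \<union> V) {c..k} (insert x T))" by (simp add: fam_insert[OF xC])
      next
        \<comment> \<open>Edge \<open>t\<close> is the last one beginning before \<open>x\<close>.
          All edges from \<open>c\<close> to \<open>t\<close> contain \<open>x\<close>, as do those
          below \<open>e\<close> by the hypothesis on early edges, so \<open>c'\<close> is the next
          edge to treat.\<close>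
        define t where "t = (x - 1) div d + 1"
        define c' where "c' = max e (t + 1)"
        have dpos: "0 < d" using s by simp
        have "(x - 1) div d * d \<le> x - 1" by (rule div_times_less_eq_dividend)
        moreover have "(t - 1) * d = (x - 1) div d * d" by (simp add: t_def)
        ultimately have t1: "(t - 1) * d < x" using xn unfolding atLeastAtMost_iff by linarith
        have "x - 1 < t * d" unfolding t_def using dividend_less_div_times[OF dpos, of "x - 1"] by (simp add: algebra_simps)
        then have t2: "x \<le> t * d" by simp
        have ct: "c \<le> t"
        proof (rule ccontr)
          assume "\<not> c \<le> t"
          then have "t * d \<le> (c - 1) * d" by (intro mult_le_mono1) simp
          then show False using x(1) t2 unfolding mem by linarith
        qed
        have c': "max (c + 1) e \<le> c'" using ct by (simp add: c'_def)
        have late: "x \<le> (i - 1) * d" if "c' \<le> i" for i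
        proof -
          have "t \<le> i - 1" using that unfolding c'_def by linarith
          then have "t * d \<le> (i - 1) * d" by (rule mult_le_mono1)
          then show ?thesis using t2 by linarith
        qed
        have "x \<in> E i" if "i \<in> {c..k} - {c'..k}" for i
        proof (cases "i \<le> t")
          case True
          then have "(i - 1) * d \<le> (t - 1) * d" by (rule mono)
          moreover have "(c - 1) * d \<le> (i - 1) * d" using that by (intro mono) simp
          ultimately show ?thesis using t1 x(1) unfolding mem by linarith
        next
          case False
          then have "c \<le> i" "i < e" "i \<le> k" using that by (auto simp: c'_def)
          then show ?thesis using early x by blast
        qed
        then have eq: "(\<lambda>T. x \<in> T \<or> fam E C (W \<union> V) {c..k} T) = fam E (insert x C) (W \<union> V) {c'..k}"
          using x c' by (intro fam_disj) auto
        \<comment> \<open>Since \<open>s < d\<close>, edge \<open>c\<close> ends before edge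
          \<open>c + q + 1\<close> begins. This makes \<open>c + q + 1\<close> the new bound beyond
          which nothing has been removed.\<close>
        have cq: "(c + q) * d = (c - 1) * d + q * d + d"
          using prems(2) by (cases c) (simp_all add: algebra_simps)
        have "?P (fam E (insert x C) (W \<union> V) {c'..k})"
        proof (rule IH[of c' "c + q + 1"])
          show "budget q k j c' (c + q + 1)" by (rule budget_step[OF prems(1) c'])
          show "1 \<le> c'" "c + q + 1 \<le> c' + q + 1" using c' by auto
          show "insert x C \<subseteq> {1..n}" using xn prems(4) by simp
          show "W \<union> V \<subseteq> {1..n}" using V Ec prems(5) by blast
          have "finite C" using prems(4) finite_subset by blast
          then show "card (insert x C) + j \<le> b" using xC prems(6) by simp
        next
          fix i assume i: "c + q + 1 \<le> i" "i \<le> k"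
          have "c + q \<le> i - 1" using i(1) by linarith
          then have "(c + q) * d \<le> (i - 1) * d" by (rule mult_le_mono1)
          then have "y \<notin> E i" if "y \<in> E c" for y
            using that cq s m unfolding mem by linarith
          then show "E i \<inter> (W \<union> V) = {}" using prems(7)[of i] prems(3) i V by auto
        next
          fix i assume i: "c' \<le> i" "i < c + q + 1" "i \<le> k"
          \<comment> \<open>By maximality of \<open>x\<close>, the unremoved part of edge
            \<open>c'\<close> lies beyond the end of edge \<open>c\<close>. Every edge up to
            \<open>c + q\<close> has begun by then, and later edges end later.\<close>
          show "E c' - (W \<union> V) \<subseteq> E i"
          proof
            fix y assume y: "y \<in> E c' - (W \<union> V)"
            then have yE: "y \<in> E c'" by simp
            then have "x < y" using late[OF order_refl] unfolding mem by linarith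
            then have "y \<notin> E c" using xmax y by fastforce
            moreover have "(c - 1) * d \<le> (c' - 1) * d" using c' by (intro mono) simp
            ultimately have "(c - 1) * d + m < y" using yE unfolding mem by linarith
            moreover have "i \<le> c + q" using i(2) by simp
            then have "(i - 1) * d \<le> (c + q - 1) * d" by (rule mono)
            moreover have "(c + q - 1) * d = (c - 1) * d + q * d"
              using prems(2) by (cases c) (simp_all add: algebra_simps)
            moreover have "(c' - 1) * d \<le> (i - 1) * d" using i(1) by (rule mono)
            ultimately show "y \<in> E i" using yE m unfolding mem by linarith
          qed
        next
          fix i assume i: "c' \<le> i" "i \<le> k"
          have "x \<notin> E i" using late[OF i(1)] unfolding mem by linarith
          moreover have "c \<le> i" using c' i(1) by simp
          ultimately show "E i \<inter> insert x C = {}" using unhit i(2) by blast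
        qed
        then show "?P (\<lambda>T. x \<in> T \<or> fam E C (W \<union> V) {c..k} T)" unfolding eq .
      qed
    qed
    from this[of "{}"] show ?thesis by simp
  qed
qed

text \<open>The splitting starts with \<open>c = e = 1\<close> and nothing adjoined or removed.
  \<open>2 * a\<close> variables account for \<open>a * (q + 1)\<close> edges; the remaining
  \<open>r + 1\<close> edges cost one variable if \<open>r = 0\<close> and two otherwise.\<close>

lemma wreg_esym_path:
  fixes d q s k n m a r :: nat
  assumes m: "m = q * d + s" and s: "s < d" and n: "(k - 1) * d + m \<le> n"
    and k: "k = 1 + a * (q + 1) + r" "r \<le> q"
  shows "wreg (polys n) (\<lambda>i. esym n (Suc i))
    (monideal n (\<lambda>T. \<exists>i\<in>{1..k}. edge d m i \<subseteq> T) :: 'a::field mpol set) (n - (2 * a + of_bool (0 < r) + 1))"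
proof -
  let ?j = "2 * a + of_bool (0 < r) + 1 :: nat"
  have "budget q k ?j 1 1" using k by (auto simp: budget_def)
  then have "wreg (polys n) (\<lambda>i. esym n (Suc i)) (monideal n (fam (edge d m) {} {} {1..k}) :: 'a mpol set) (n - ?j)"
    by (intro wreg_esym_fam[OF m s n, where j = ?j and e = 1]) auto
  moreover have "fam (edge d m) {} {} {1..k} = (\<lambda>T. \<exists>i\<in>{1..k}. edge d m i \<subseteq> T)"
    by (simp add: fam_def fun_eq_iff)
  ultimately show ?thesis by metis
qed

section \<open>A Koszul class of the path ideal\<close>

lemma lookup_X_mult:
  fixes w :: "'a::field mpol"
  assumes "finite G"
  shows "Poly_Mapping.lookup (X j * w) (sqf G) = (if j \<in> G then Poly_Mapping.lookup w (sqf (G - {j})) else 0)"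
proof (cases "j \<in> G")
  case True
  then have "sqf G = sqf {j} + sqf (G - {j})"
    using sqf_union[of "{j}" "G - {j}"] assms by (simp add: insert_absorb)
  then show ?thesis using True by (simp add: X_eq_sqmon sqmon_def lookup_single_mult)
next
  case False
  have "sqf G \<notin> Poly_Mapping.keys (X j * w)"
  proof
    assume "sqf G \<in> Poly_Mapping.keys (X j * w)"
    then obtain t where "sqf G = sqf {j} + t"
      by (auto simp: X_eq_sqmon sqmon_def keys_single_mult)
    then have "Poly_Mapping.keys (sqf G) = {j} \<union> Poly_Mapping.keys t" by (simp add: keys_plus keys_sqf)
    then show False using False assms by (simp add: keys_sqf)
  qed
  then show ?thesis using False by (simp add: in_keys_iff)
qed

text \<open>The sign is a polynomial on the left and a scalar on the right.\<close>

lemma lookup_sg_mult: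
  fixes y :: "'a::field mpol"
  shows "Poly_Mapping.lookup (sg T j * y) t = sg T j * Poly_Mapping.lookup y t"
proof (cases "even (card {i \<in> T. i < j})")
  case True
  then show ?thesis by (simp add: sg_def)
next
  case False
  then show ?thesis by (simp add: sg_def)
qed

locale blocks =
  fixes n p :: nat and D :: "nat \<Rightarrow> nat set"
  assumes D_subset: "\<And>i. i \<le> p \<Longrightarrow> D i \<subseteq> {1..n}"
    and D_less: "\<And>i j x y. i < j \<Longrightarrow> j \<le> p \<Longrightarrow> x \<in> D i \<Longrightarrow> y \<in> D j \<Longrightarrow> x < y"
begin

definition F :: "nat set" where "F = (\<Union>i\<le>p. D i)"

text \<open>Only the \<open>p\<close> blocks before the last are used: these sets index coefficients
  of chains of degree \<open>p\<close>, and \<open>D p\<close> supplies the extra index in degree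
  \<open>p + 1\<close>.\<close>

definition transversals :: "nat set set" where
  "transversals = {T. T \<subseteq> (\<Union>i<p. D i) \<and> (\<forall>i<p. \<exists>!x. x \<in> T \<and> x \<in> D i)}"

lemma F_subset: "F \<subseteq> {1..n}"
  using D_subset by (auto simp: F_def)

lemma finite_F: "finite F"
  using F_subset finite_subset by blast

lemma D_unique: "i \<le> p \<Longrightarrow> j \<le> p \<Longrightarrow> x \<in> D i \<Longrightarrow> x \<in> D j \<Longrightarrow> i = j"
  using D_less[of i j x x] D_less[of j i x x] by (cases i j rule: linorder_cases) auto

lemma UN_subset_F: "(\<Union>i<p. D i) \<subseteq> F"
  unfolding F_def by (rule UN_mono) auto

lemma F_eq: "F = (\<Union>i<p. D i) \<union> D p"
proof -
  have "{..p} = insert p {..<p}" by auto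
  then show ?thesis by (simp add: F_def Un_commute)
qed

lemma last_disjoint: "(\<Union>i<p. D i) \<inter> D p = {}"
proof (intro equals0I)
  fix x assume "x \<in> (\<Union>i<p. D i) \<inter> D p"
  then obtain i where "i < p" "x \<in> D i" "x \<in> D p" by blast
  then show False using D_unique[of i p x] by simp
qed

lemma transversals_subset: "T \<in> transversals \<Longrightarrow> T \<subseteq> F"
  using UN_subset_F by (auto simp: transversals_def)

lemma transversal_block: "T \<in> transversals \<Longrightarrow> x \<in> T \<Longrightarrow> \<exists>i<p. x \<in> D i"
  unfolding transversals_def by blast

lemma transversal_meets: "T \<in> transversals \<Longrightarrow> i < p \<Longrightarrow> \<exists>x\<in>T. x \<in> D i"
  unfolding transversals_def by blast

lemma finite_transversals: "finite transversals"
  by (rule finite_subset[of _ "Pow F"]) (use transversals_subset finite_F in auto)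

definition blk :: "nat \<Rightarrow> nat" where "blk j = (THE i. i < p \<and> j \<in> D i)"

definition rep :: "nat set \<Rightarrow> nat \<Rightarrow> nat" where "rep T j = (THE y. y \<in> T \<and> y \<in> D (blk j))"

lemma blk_eq: "i < p \<Longrightarrow> j \<in> D i \<Longrightarrow> blk j = i"
  unfolding blk_def by (rule the_equality) (auto dest: D_unique[rotated 2])

lemma rep:
  assumes "T \<in> transversals" "i < p" "j \<in> D i"
  shows "rep T j \<in> T" "rep T j \<in> D i" "y \<in> T \<Longrightarrow> y \<in> D i \<Longrightarrow> y = rep T j"
proof -
  have "\<exists>!y. y \<in> T \<and> y \<in> D i" using assms by (simp add: transversals_def)
  from theI'[OF this] this show "rep T j \<in> T" "rep T j \<in> D i" "y \<in> T \<Longrightarrow> y \<in> D i \<Longrightarrow> y = rep T j"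
    unfolding rep_def blk_eq[OF assms(2,3)] by blast+
qed

text \<open>Trading \<open>j\<close> for the member of \<open>T\<close> in its block is an
  involution on pairs that preserves \<open>insert j T\<close>. No other element of \<open>T\<close>
  lies between the two traded ones, because blocks are ordered; so exactly one of the two signs sees
  an extra smaller element.\<close>

lemma exchange:
  assumes T: "T \<in> transversals" and i: "i < p" and j: "j \<in> D i" "j \<notin> T"
  defines "T' \<equiv> insert j (T - {rep T j})"
  shows "T' \<in> transversals" "rep T j \<notin> T'" "rep T' (rep T j) = j" "insert (rep T j) (T' - {j}) = T"
    and "sg T' (rep T j) = (- sg T j :: 'a::field)"
proof -
  let ?r = "rep T j" and ?B = "T - {rep T j}"
  note r = rep[OF T i j(1)]
  have rj: "?r \<noteq> j" using r(1) j(2) by auto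
  have "\<exists>!x. x \<in> T' \<and> x \<in> D i'" if i': "i' < p" for i'
  proof (cases "i' = i")
    case True
    then show ?thesis using r(3) j(1) by (auto simp: T'_def)
  next
    case False
    have "j \<notin> D i'" "?r \<notin> D i'" using D_unique[of i i'] False i i' j(1) r(2) by auto
    then have "x \<in> T' \<and> x \<in> D i' \<longleftrightarrow> x \<in> T \<and> x \<in> D i'" for x by (auto simp: T'_def)
    then show ?thesis using T i' by (simp add: transversals_def)
  qed
  moreover have "T' \<subseteq> (\<Union>i<p. D i)" using T i j(1) by (auto simp: T'_def transversals_def)
  ultimately show T': "T' \<in> transversals" by (simp add: transversals_def)
  show "?r \<notin> T'" using rj by (simp add: T'_def)
  have "j \<in> T'" by (simp add: T'_def)
  from rep(3)[OF T' i r(2) this j(1)] show "rep T' ?r = j" by simp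
  show "insert ?r (T' - {j}) = T" using r(1) j(2) by (auto simp: T'_def)
  have finB: "finite ?B" using finite_subset[OF transversals_subset[OF T] finite_F] by simp
  have "a < j \<longleftrightarrow> a < ?r" if "a \<in> ?B" for a
  proof -
    obtain i' where i': "i' < p" "a \<in> D i'" using \<open>a \<in> ?B\<close> transversal_block[OF T] by blast
    then have "i' \<noteq> i" using r(3) that by auto
    then show ?thesis using D_less[of i' i a] D_less[of i i' _ a] i i' j(1) r(2)
      by (cases i' i rule: linorder_cases) fastforce+
  qed
  then have "{a \<in> ?B. a < j} = {a \<in> ?B. a < ?r}" by auto
  then have eq: "sg ?B j = (sg ?B ?r :: 'a)" by (simp add: sg_def)
  have T: "T = insert ?r ?B" using r(1) by auto
  show "sg T' ?r = (- sg T j :: 'a)"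
  proof (cases "j < ?r")
    case True
    have "sg T j = (sg ?B j :: 'a)" by (subst T) (rule sg_insert(1)[OF True _ finB], use j in simp)
    moreover have "sg T' ?r = (- sg ?B ?r :: 'a)" unfolding T'_def by (rule sg_insert(2)[OF True _ finB]) (use j in simp)
    ultimately show ?thesis using eq by simp
  next
    case False
    then have lt: "?r < j" using rj by simp
    have "sg T j = (- sg ?B j :: 'a)" by (subst T) (rule sg_insert(2)[OF lt _ finB], simp)
    moreover have "sg T' ?r = (sg ?B ?r :: 'a)" unfolding T'_def by (rule sg_insert(1)[OF lt _ finB]) simp
    ultimately show ?thesis using eq by simp
  qed
qed

text \<open>
  Dually, the wedge product of the sums of the dual basis vectors over \<open>D 0, \<dots>, D (p - 1)\<close>
  is taken to the one over \<open>D 0, \<dots>, D p\<close> by the codifferential, which is the wedge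
  product with the sum over \<open>F\<close>.
\<close>

lemma sum_transversals_bd:
  fixes v :: "nat set \<Rightarrow> 'a::field mpol"
  shows "(\<Sum>T\<in>transversals. Poly_Mapping.lookup (bd {1..n} X v T) (sqf (F - T)))
    = (\<Sum>T\<in>transversals. \<Sum>j\<in>D p. sg T j * Poly_Mapping.lookup (v (insert j T)) (sqf (F - insert j T)))"
proof -
  let ?G = "\<lambda>T j. sg T j * Poly_Mapping.lookup (v (insert j T)) (sqf (F - insert j T))"
  let ?F' = "\<Union>i<p. D i"
  have finF': "finite ?F'" by (rule finite_subset[OF UN_subset_F finite_F])
  have "Poly_Mapping.lookup (bd {1..n} X v T) (sqf (F - T)) = (\<Sum>j\<in>?F' - T. ?G T j) + (\<Sum>j\<in>D p. ?G T j)"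
    if T: "T \<in> transversals" for T
  proof -
    have FT: "F - T = (?F' - T) \<union> D p"
    proof -
      have "T \<inter> D p = {}" using T last_disjoint by (auto simp: transversals_def)
      then show ?thesis by (auto simp: F_eq)
    qed
    have "Poly_Mapping.lookup (bd {1..n} X v T) (sqf (F - T))
        = (\<Sum>j\<in>{1..n} - T. Poly_Mapping.lookup (sg T j * (X j * v (insert j T))) (sqf (F - T)))"
      by (simp add: bd_def lookup_sum mult.assoc)
    \<comment> \<open>An index outside \<open>F\<close> contributes nothing, since its variable does
      not divide the monomial of \<open>F - T\<close>.\<close>
    also have "\<dots> = (\<Sum>j\<in>F - T. Poly_Mapping.lookup (sg T j * (X j * v (insert j T))) (sqf (F - T)))"
      using F_subset finite_F by (intro sum.mono_neutral_right) (auto simp: lookup_sg_mult lookup_X_mult)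
    also have "\<dots> = (\<Sum>j\<in>F - T. ?G T j)"
      using finite_F by (intro sum.cong refl) (simp add: lookup_sg_mult lookup_X_mult insert_Diff_if flip: Diff_insert)
    also have "\<dots> = (\<Sum>j\<in>?F' - T. ?G T j) + (\<Sum>j\<in>D p. ?G T j)"
      unfolding FT
    proof (rule sum.union_disjoint)
      show "finite (?F' - T)" using finF' by simp
      show "finite (D p)" using finite_F by (simp add: F_eq)
      show "(?F' - T) \<inter> D p = {}" using last_disjoint by blast
    qed
    finally show ?thesis .
  qed
  then have "(\<Sum>T\<in>transversals. Poly_Mapping.lookup (bd {1..n} X v T) (sqf (F - T)))
      = (\<Sum>T\<in>transversals. \<Sum>j\<in>?F' - T. ?G T j) + (\<Sum>T\<in>transversals. \<Sum>j\<in>D p. ?G T j)"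
    by (simp add: sum.distrib)
  also have "(\<Sum>T\<in>transversals. \<Sum>j\<in>?F' - T. ?G T j) = (\<Sum>(T, j)\<in>Sigma transversals (\<lambda>T. ?F' - T). ?G T j)"
    using finF' finite_transversals by (intro sum.Sigma) auto
  also have "\<dots> = 0"
  \<comment> \<open>Apart from its sign a term depends only on \<open>insert j T\<close>, which
    \<open>exchange\<close> preserves.\<close>
  proof (rule sum_involution_eq_0[where \<iota> = "\<lambda>(T, j). (insert j (T - {rep T j}), rep T j)" and Q = "\<lambda>(T, j). j < rep T j"])
    show "finite (Sigma transversals (\<lambda>T. ?F' - T))" using finF' finite_transversals by auto
    fix P assume "P \<in> Sigma transversals (\<lambda>T. ?F' - T)"
    then obtain T j i where P: "P = (T, j)" and T: "T \<in> transversals" and j: "i < p" "j \<in> D i" "j \<notin> T" by auto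
    note ex = exchange[OF T j] and r = rep[OF T j(1,2)]
    let ?T' = "insert j (T - {rep T j})"
    show "(case P of (T, j) \<Rightarrow> (insert j (T - {rep T j}), rep T j)) \<in> Sigma transversals (\<lambda>T. ?F' - T)"
      using ex(1,2) r(2) j(1) P by auto
    show "(case case P of (T, j) \<Rightarrow> (insert j (T - {rep T j}), rep T j) of (T, j) \<Rightarrow> (insert j (T - {rep T j}), rep T j)) = P"
      unfolding P prod.case ex(3,4) ..
    have "insert (rep T j) ?T' = insert j T" using r(1) by auto
    then show "(case case P of (T, j) \<Rightarrow> (insert j (T - {rep T j}), rep T j) of (T, j) \<Rightarrow> ?G T j) = - (case P of (T, j) \<Rightarrow> ?G T j)"
      unfolding P prod.case ex(5) by simp
    have "j \<noteq> rep T j" using j(3) r(1) by auto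
    then show "(case case P of (T, j) \<Rightarrow> (insert j (T - {rep T j}), rep T j) of (T, j) \<Rightarrow> j < rep T j) \<longleftrightarrow> \<not> (case P of (T, j) \<Rightarrow> j < rep T j)"
      unfolding P prod.case ex(3) by auto
  qed
  finally show ?thesis by simp
qed

text \<open>The chain \<open>u\<close> has the single coefficient \<open>sqmon (F - C)\<close> at
  \<open>C\<close>, where \<open>C\<close> consists of the \<open>g i\<close>. Its boundary has
  coefficients in the ideal because multiplying by \<open>X (g i)\<close> completes the edge
  supplied by \<open>priv\<close>. It bounds no chain over the ideal, because the functional of
  \<open>sum_transversals_bd\<close> separates the two sides.\<close>

lemma essential_transversal:
  fixes \<E> :: "nat set set"
  assumes full: "\<And>E. E \<in> \<E> \<Longrightarrow> \<exists>i\<le>p. D i \<subseteq> E"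
    and g: "\<And>i. i \<le> p \<Longrightarrow> g i \<in> D i"
    and priv: "\<And>i. i \<le> p \<Longrightarrow> \<exists>E\<in>\<E>. E \<subseteq> F \<and> E \<inter> g ` {..p} \<subseteq> {g i}"
  shows "\<exists>z. poly.essential {1..n} X (monideal n (\<lambda>T. \<exists>E\<in>\<E>. E \<subseteq> T) :: 'a::field mpol set) {0} p z"
proof -
  let ?M = "monideal n (\<lambda>T. \<exists>E\<in>\<E>. E \<subseteq> T) :: 'a mpol set"
  let ?L = Poly_Mapping.lookup
  define C where "C = g ` {..p}"
  define u :: "nat set \<Rightarrow> 'a mpol" where "u S = (if S = C then sqmon (F - C) else 0)" for S
  define z where "z = bd {1..n} X u"
  have M: "poly.idl n ?M" by (rule idl_monideal) (auto simp: upward_def)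
  have CF: "C \<subseteq> F" using g by (auto simp: C_def F_def)
  have finC: "finite C" by (simp add: C_def)
  have "inj_on g {..p}"
  proof (rule inj_onI)
    fix i j assume "i \<in> {..p}" "j \<in> {..p}" "g i = g j"
    then show "i = j" using D_unique[of i j "g i"] g[of i] g[of j] by auto
  qed
  then have cardC: "card C = Suc p" by (simp add: C_def card_image)
  have u: "chain {1..n} (polys n) (Suc p) u"
  proof (rule chainI)
    show "u S \<in> polys n" for S using F_subset poly.zero_closed by (auto simp: u_def intro!: sqmon_closed)
    show "S \<subseteq> {1..n} \<and> card S = Suc p" if "u S \<noteq> 0" for S
      using that CF F_subset cardC by (auto simp: u_def split: if_splits)
  qed
  have zc: "chain {1..n} (polys n) p z" unfolding z_def
    by (rule poly.chain_bd[OF poly.idl_R _ X_closed u]) auto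
  have zM: "z S \<in> ?M" for S
    unfolding z_def bd_def
  proof (rule poly.idl_sum[OF M])
    fix j assume j: "j \<in> {1..n} - S"
    show "sg S j * X j * u (insert j S) \<in> ?M"
    proof (cases "insert j S = C")
      case True
      then obtain i where i: "i \<le> p" "j = g i" by (auto simp: C_def)
      then obtain E where E: "E \<in> \<E>" "E \<subseteq> F" "E \<inter> C \<subseteq> {j}" using priv[of i] by (auto simp: C_def)
      have "insert j (F - C) \<subseteq> {1..n}" using F_subset j by auto
      moreover have "j \<notin> F - C" using True by auto
      then have "X j * sqmon (F - C) = (sqmon (insert j (F - C)) :: 'a mpol)"
        using sqmon_union[of "{j}" "F - C", where 'a = 'a] finite_F by (simp add: X_eq_sqmon)
      moreover have "E \<subseteq> insert j (F - C)" using E by auto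
      ultimately have "X j * u (insert j S) \<in> ?M"
        using True E(1) finite_F by (auto simp: u_def monideal_iff keys_sqf)
      from poly.idlD(4)[OF M poly.sg_closed this] show ?thesis by (simp add: mult.assoc)
    next
      case False
      then show ?thesis using poly.idlD(2)[OF M] by (simp add: u_def)
    qed
  qed
  have "chain {1..n} ?M p z" by (rule chainI[OF zM chain_supp[OF zc]])
  moreover have "bd {1..n} X z S \<in> {0}" for S
  proof (cases "finite S")
    case True
    then show ?thesis by (simp add: z_def bd_bd)
  next
    case False
    then have "\<not> insert j S \<subseteq> {1..n}" for j using finite_subset[of "insert j S" "{1..n}"] by auto
    then have "z (insert j S) = 0" for j using chain_supp[OF zc] by blast
    then show ?thesis by (simp add: bd_def)
  qed
  moreover have False if v: "chain {1..n} ?M (Suc p) v" "\<And>S. z S - bd {1..n} X v S \<in> {0}" for v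
  proof -
    have "z S = bd {1..n} X v S" for S using v(2)[of S] by simp
    then have "(\<Sum>T\<in>transversals. ?L (bd {1..n} X u T) (sqf (F - T)))
        = (\<Sum>T\<in>transversals. ?L (bd {1..n} X v T) (sqf (F - T)))"
      by (simp add: z_def)
    then have "(\<Sum>T\<in>transversals. \<Sum>j\<in>D p. sg T j * ?L (u (insert j T)) (sqf (F - insert j T)))
        = (\<Sum>T\<in>transversals. \<Sum>j\<in>D p. sg T j * ?L (v (insert j T)) (sqf (F - insert j T)))"
      unfolding sum_transversals_bd .
    \<comment> \<open>Removing \<open>insert j T\<close> from \<open>F\<close> destroys every block,
      hence by \<open>full\<close> every edge, so the coefficient cannot occur in the ideal.\<close>
    also have "\<dots> = 0"
    proof (intro sum.neutral ballI)
      fix T j assume T: "T \<in> transversals" and j: "j \<in> D p"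
      let ?S = "insert j T"
      have "sqf (F - ?S) \<notin> Poly_Mapping.keys (v ?S)"
      proof
        assume "sqf (F - ?S) \<in> Poly_Mapping.keys (v ?S)"
        then have "\<exists>E\<in>\<E>. E \<subseteq> Poly_Mapping.keys (sqf (F - ?S))"
          using chain_closed[OF v(1), of ?S] unfolding monideal_iff by blast
        then obtain E where E: "E \<in> \<E>" "E \<subseteq> F - ?S" using finite_F by (auto simp: keys_sqf)
        then obtain i where i: "i \<le> p" "D i \<subseteq> F - ?S" using full by blast
        have "?S \<inter> D i \<noteq> {}" using transversal_meets[OF T, of i] j i(1) by (cases "i = p") auto
        then show False using i(2) by auto
      qed
      then show "sg T j * ?L (v ?S) (sqf (F - ?S)) = 0" by (simp add: in_keys_iff)
    qed
    finally have zero: "(\<Sum>T\<in>transversals. \<Sum>j\<in>D p. sg T j * ?L (u (insert j T)) (sqf (F - insert j T))) = 0" .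
    \<comment> \<open>On \<open>u\<close> the sum has just one nonzero term, where
      \<open>insert j T = C\<close>; it is a sign and hence nonzero.\<close>
    let ?T = "C - {g p}"
    have gp: "g p \<in> C" "g p \<in> D p" using g by (auto simp: C_def)
    have CD: "x = g i" if "x \<in> C" "x \<in> D i" "i \<le> p" for x i
      using that g D_unique by (fastforce simp: C_def)
    have "g i \<in> ?T" if "i < p" for i
      using that g[of i] g[of p] D_unique[of i p "g i"] by (auto simp: C_def)
    then have "\<exists>!x. x \<in> ?T \<and> x \<in> D i" if "i < p" for i
      using that g[of i] CD[of _ i] by (intro ex1I[of _ "g i"]) auto
    moreover have "?T \<subseteq> (\<Union>i<p. D i)" using g by (fastforce simp: C_def le_less)
    ultimately have T: "?T \<in> transversals" by (simp add: transversals_def)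
    have finD: "finite (D p)" using D_subset[of p] finite_subset by auto
    have "(\<Sum>T\<in>transversals. \<Sum>j\<in>D p. sg T j * ?L (u (insert j T)) (sqf (F - insert j T)))
        = (\<Sum>(T, j)\<in>transversals \<times> D p. sg T j * ?L (u (insert j T)) (sqf (F - insert j T)))"
      by (rule sum.cartesian_product)
    also have "\<dots> = (\<Sum>(T, j)\<in>{(?T, g p)}. sg T j * ?L (u (insert j T)) (sqf (F - insert j T)))"
    proof (rule sum.mono_neutral_right)
      show "finite (transversals \<times> D p)" using finite_transversals finD by simp
      show "{(?T, g p)} \<subseteq> transversals \<times> D p" using T gp by simp
      have neq: "insert j S \<noteq> C" if "S \<in> transversals" "j \<in> D p" "(S, j) \<noteq> (?T, g p)" for S j
      proof
        assume eq: "insert j S = C"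
        then have "j = g p" using CD[of j p] that(2) by auto
        moreover have "g p \<notin> S"
        proof
          assume "g p \<in> S"
          then obtain i where "i < p" "g p \<in> D i" using transversal_block[OF \<open>S \<in> transversals\<close>] by blast
          then show False using D_unique[of i p "g p"] gp(2) by simp
        qed
        ultimately show False using that(3) eq by auto
      qed
      show "\<forall>x\<in>transversals \<times> D p - {(?T, g p)}.
          (case x of (T, j) \<Rightarrow> sg T j * ?L (u (insert j T)) (sqf (F - insert j T))) = 0"
      proof
        fix x assume "x \<in> transversals \<times> D p - {(?T, g p)}"
        then obtain S j where x: "x = (S, j)" "S \<in> transversals" "j \<in> D p" "(S, j) \<noteq> (?T, g p)" by blast
        show "(case x of (T, j) \<Rightarrow> sg T j * ?L (u (insert j T)) (sqf (F - insert j T))) = 0"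
          using neq[OF x(2-4)] by (simp add: x(1) u_def)
      qed
    qed
    also have "\<dots> = sg ?T (g p)"
      using gp(1) by (simp add: u_def insert_absorb sqmon_def)
    finally have "sg ?T (g p) = (0::'a)" using zero by simp
    then show False by (simp add: sg_def)
  qed
  ultimately show ?thesis unfolding poly.essential_def by blast
qed

end

text \<open>The blocks alternate between lengths \<open>q * d\<close> and \<open>d\<close>, except
  that the first is enlarged by \<open>s\<close> to become edge 1. A period of two blocks has length
  \<open>w\<close> and corresponds to \<open>q + 1\<close> edges.\<close>

lemma essential_path:
  fixes d q s k n m a r :: nat
  assumes m: "m = q * d + s" and s: "s < d" and q: "1 \<le> q" and n: "(k - 1) * d + m \<le> n"
    and k: "k = 1 + a * (q + 1) + r" and r: "r \<le> q" and p: "p = 2 * a + of_bool (0 < r)"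
  shows "\<exists>z. poly.essential {1..n} X
    (monideal n (\<lambda>T. \<exists>E\<in>edge d m ` {1..k}. E \<subseteq> T) :: 'a::field mpol set) {0} p z"
proof -
  define w where "w = q * d + d"
  \<comment> \<open>\<open>b (i + 1)\<close> is the end of block \<open>i\<close>. The value
    \<open>b 0 = s\<close> is not the start of block 0, but makes \<open>g 0\<close> below the point
    \<open>s + 1\<close>.\<close>
  define b where "b i = s + i div 2 * w + i mod 2 * (q * d)" for i
  define D where "D i = {(if i = 0 then 0 else b i) + 1..b (i + 1)}" for i
  have b_even: "b (2 * t) = s + t * w" for t by (simp add: b_def)
  have b_odd: "b (2 * t + 1) = s + t * w + q * d" for t by (simp add: b_def)
  have b_odd': "b (Suc (2 * t)) = s + t * w + q * d" for t using b_odd[of t] by simp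
  have b_even': "b (2 * t + 2) = s + t * w + w" for t using b_even[of "t + 1"] by simp
  have qd: "0 < q * d" using q s by simp
  have b_Suc: "b i < b (Suc i)" for i
  proof (cases "even i")
    case True
    then obtain t where "i = 2 * t" by (rule evenE)
    then show ?thesis using b_even[of t] b_odd'[of t] qd by simp
  next
    case False
    then obtain t where "i = 2 * t + 1" by (rule oddE)
    then show ?thesis using b_odd[of t] b_even'[of t] s by (simp add: w_def)
  qed
  have b_mono: "b i \<le> b j" if "i \<le> j" for i j
    by (rule lift_Suc_mono_le[of b, OF less_imp_le[OF b_Suc] that])
  have kd: "(k - 1) * d = a * w + r * d" by (simp add: k w_def algebra_simps)
  have b_n: "b (p + 1) \<le> n"
  proof (cases "r = 0")
    case True
    then show ?thesis using b_odd[of a] n m kd p by simp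
  next
    case False
    then have "d \<le> r * d" by simp
    moreover have "b (p + 1) = s + a * w + w" using b_even'[of a] p False by simp
    ultimately show ?thesis using n m kd w_def by linarith
  qed
  have D_sub: "D i \<subseteq> {1..n}" if "i \<le> p" for i
  proof -
    have "b (i + 1) \<le> n" using b_mono[of "i + 1" "p + 1"] b_n that by simp
    then show ?thesis by (auto simp: D_def)
  qed
  interpret blocks n p D
  proof
    show "D i \<subseteq> {1..n}" if "i \<le> p" for i by (rule D_sub[OF that])
    fix i j x y assume "i < j" "j \<le> p" "x \<in> D i" "y \<in> D j"
    then have "x \<le> b (i + 1)" "b j < y" by (auto simp: D_def)
    moreover have "b (i + 1) \<le> b j" using \<open>i < j\<close> by (intro b_mono) simp
    ultimately show "x < y" by linarith
  qed
  have cover: "\<exists>i\<le>j. x \<in> D i" if "1 \<le> x" "x \<le> b (j + 1)" for x j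
    using that
  proof (induction j)
    case 0
    then show ?case by (simp add: D_def)
  next
    case (Suc j)
    show ?case
    proof (cases "x \<le> b (j + 1)")
      case True
      then show ?thesis using Suc by (meson le_SucI)
    next
      case False
      then have "x \<in> D (Suc j)" using Suc.prems by (simp add: D_def)
      then show ?thesis by blast
    qed
  qed
  have mem: "x \<in> edge d m i \<longleftrightarrow> (i - 1) * d < x \<and> x \<le> (i - 1) * d + m" for x i
    by (auto simp: edge_def)
  \<comment> \<open>The edge with \<open>i - 1 = t * (q + 1) + u\<close> contains block
    \<open>2 * t\<close> if \<open>u = 0\<close>, and block \<open>2 * t + 1\<close>
    otherwise.\<close>
  have full: "\<exists>j\<le>p. D j \<subseteq> edge d m i" if i: "i \<in> {1..k}" for i
  proof -
    define t where "t = (i - 1) div (q + 1)"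
    define u where "u = (i - 1) mod (q + 1)"
    have i1: "i - 1 = t * (q + 1) + u" by (simp only: t_def u_def div_mult_mod_eq)
    then have id: "(i - 1) * d = t * w + u * d" by (simp add: w_def algebra_simps)
    have u: "u \<le> q" by (simp add: u_def less_Suc_eq_le[symmetric])
    have le: "t * (q + 1) + u \<le> a * (q + 1) + r" using i i1 k unfolding atLeastAtMost_iff by linarith
    have ta: "t \<le> a"
    proof (rule ccontr)
      assume "\<not> t \<le> a"
      then have "(a + 1) * (q + 1) \<le> t * (q + 1)" by (intro mult_le_mono1) simp
      then show False using le r by simp
    qed
    show ?thesis
    proof (cases "u = 0")
      case True
      have "D (2 * t) \<subseteq> edge d m i"
      proof
        fix x assume "x \<in> D (2 * t)"
        then have "t * w < x" "x \<le> s + t * w + q * d"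
          using b_even[of t] b_odd'[of t] by (auto simp: D_def split: if_splits)
        then show "x \<in> edge d m i" using id True m unfolding mem by simp
      qed
      moreover have "2 * t \<le> p" using ta p by simp
      ultimately show ?thesis by blast
    next
      case False
      have "2 * t + 1 \<le> p"
      proof (cases "t = a")
        case True
        then show ?thesis using le False p by simp
      next
        case False
        then show ?thesis using ta p by simp
      qed
      moreover have "D (2 * t + 1) \<subseteq> edge d m i"
      proof
        fix x assume "x \<in> D (2 * t + 1)"
        then have "s + t * w + q * d < x" "x \<le> s + t * w + w"
          using b_odd'[of t] b_even'[of t] by (auto simp: D_def)
        moreover have "u * d \<le> q * d" "d \<le> u * d" using u False by auto
        ultimately show "x \<in> edge d m i" using id m w_def unfolding mem by linarith
      qed
      ultimately show ?thesis by blast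
    qed
  qed
  define g where "g i = b i + 1" for i
  have gD: "g i \<in> D i" for i
    using b_Suc[of i] by (auto simp: D_def g_def)
  have priv: "\<exists>E\<in>edge d m ` {1..k}. E \<subseteq> F \<and> E \<inter> g ` {..p} \<subseteq> {g i}" if i: "i \<le> p" for i
  proof -
    \<comment> \<open>Edge \<open>e\<close> is the one ending together with block \<open>i\<close>.
      It therefore ends before every later \<open>g j\<close>, and \<open>s < d\<close> makes it
      begin no earlier than any \<open>g j\<close> with \<open>j < i\<close>.\<close>
    define e where "e = 1 + i div 2 * (q + 1) + i mod 2"
    have ed: "(e - 1) * d = i div 2 * w + i mod 2 * d" by (simp add: e_def w_def algebra_simps)
    have last: "(e - 1) * d + m = b (i + 1)"
    proof (cases "even i")
      case True
      then obtain t where "i = 2 * t" by (rule evenE)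
      then show ?thesis using b_odd'[of t] ed m by simp
    next
      case False
      then obtain t where "i = 2 * t + 1" by (rule oddE)
      then show ?thesis using b_even'[of t] ed m by (simp add: w_def)
    qed
    have first: "b j + 1 \<le> (e - 1) * d" if "j < i" for j
    proof -
      have "b j \<le> b (i - 1)" using that by (intro b_mono) simp
      moreover have "b (i - 1) + 1 \<le> (e - 1) * d"
      proof (cases "even i")
        case True
        then obtain t where t: "i = 2 * t" by (rule evenE)
        then obtain t' where "t = Suc t'" using \<open>j < i\<close> by (cases t) auto
        then show ?thesis using t b_odd'[of t'] ed s by (simp add: w_def)
      next
        case False
        then obtain t where "i = 2 * t + 1" by (rule oddE)
        then show ?thesis using b_even[of t] ed s by simp
      qed
      ultimately show ?thesis by simp
    qed
    have "e \<le> k"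
    proof (cases "i div 2 = a")
      case True
      then have "i mod 2 \<le> r" using i p by (auto simp: of_bool_def split: if_splits) presburger+
      then show ?thesis using True k by (simp add: e_def)
    next
      case False
      then have "i div 2 < a" using i p by (auto simp: of_bool_def split: if_splits)
      then have "(i div 2 + 1) * (q + 1) \<le> a * (q + 1)" by (intro mult_le_mono1) simp
      moreover have "i mod 2 \<le> 1" by simp
      ultimately show ?thesis using k q unfolding e_def by simp
    qed
    then have "e \<in> {1..k}" by (simp add: e_def)
    moreover have "edge d m e \<subseteq> F"
    proof
      fix x assume "x \<in> edge d m e"
      then have "1 \<le> x" "x \<le> b (i + 1)" unfolding mem last by auto
      then have "\<exists>j\<le>i. x \<in> D j" by (rule cover)
      then show "x \<in> F" using i order_trans by (fastforce simp: F_def)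
    qed
    moreover have "edge d m e \<inter> g ` {..p} \<subseteq> {g i}"
    proof
      fix x assume x: "x \<in> edge d m e \<inter> g ` {..p}"
      then obtain j where j: "x = b j + 1" by (auto simp: g_def)
      have "(e - 1) * d < x" "x \<le> b (i + 1)" using x unfolding Int_iff mem last by auto
      moreover have "b (i + 1) \<le> b j" if "i < j" using that by (intro b_mono) simp
      ultimately have "j = i" using first[of j] j by (cases i j rule: linorder_cases) auto
      then show "x \<in> {g i}" by (simp add: j g_def)
    qed
    ultimately show ?thesis by blast
  qed
  show ?thesis
    by (rule essential_transversal[of _ g]) (use full gD priv in auto)
qed

section \<open>Depth of the path ideal\<close>

lemma extend_seq_eq_sums:
  "extend_seq M f {0} r = {\<Sum>j<r. f j * w j | w. \<forall>j<r. w j \<in> M}"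
proof (induction r)
  case (Suc r)
  show ?case
  proof (intro Set.set_eqI iffI)
    fix y assume "y \<in> extend_seq M f {0} (Suc r)"
    then obtain w v where w: "\<forall>j<r. w j \<in> M" "v \<in> M" "y = (\<Sum>j<r. f j * w j) + f r * v"
      unfolding extend_seq.simps Suc by auto
    have "y = (\<Sum>j<Suc r. f j * (w(r := v)) j)" using w(3) by simp
    moreover have "\<forall>j<Suc r. (w(r := v)) j \<in> M" using w by (simp add: less_Suc_eq)
    ultimately show "y \<in> {\<Sum>j<Suc r. f j * w j | w. \<forall>j<Suc r. w j \<in> M}" by blast
  next
    fix y assume "y \<in> {\<Sum>j<Suc r. f j * w j | w. \<forall>j<Suc r. w j \<in> M}"
    then obtain w where w: "\<forall>j<Suc r. w j \<in> M" "y = (\<Sum>j<r. f j * w j) + f r * w r" by auto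
    then have "(\<Sum>j<r. f j * w j) \<in> extend_seq M f {0} r" unfolding Suc by auto
    then show "y \<in> extend_seq M f {0} (Suc r)" using w extend_SucI by auto
  qed
qed auto

lemma ideal_module_simps [simp]:
  "carrier (ideal_module R J) = J" "x \<oplus>\<^bsub>ideal_module R J\<^esub> y = x \<oplus>\<^bsub>R\<^esub> y"
  "\<zero>\<^bsub>ideal_module R J\<^esub> = \<zero>\<^bsub>R\<^esub>" "x \<odot>\<^bsub>ideal_module R J\<^esub> y = x \<otimes>\<^bsub>R\<^esub> y"
  by (simp_all add: ideal_module_def)

lemma finsum_ideal_module:
  fixes J :: "'a::field mpol set" and r :: nat
  assumes J: "poly.idl n J" and g: "\<And>j. j < r \<Longrightarrow> g j \<in> J"
  shows "finsum (ideal_module (poly_ring K n) J) g {..<r} = (\<Sum>j<r. g j)"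
proof -
  interpret M: Module.module "poly_ring K n" "ideal_module (poly_ring K n) J"
    by (rule ideal_module_module[OF poly_ring_cring ideal_idl[OF J]])
  show ?thesis using g
  proof (induction r)
    case 0
    then show ?case by simp
  next
    case (Suc r)
    have "finsum (ideal_module (poly_ring K n) J) g (insert r {..<r})
        = g r \<oplus>\<^bsub>ideal_module (poly_ring K n) J\<^esub> finsum (ideal_module (poly_ring K n) J) g {..<r}"
      using Suc.prems by (intro M.finsum_insert) auto
    then show ?case using Suc by (simp add: lessThan_Suc add.commute)
  qed
qed

lemma seq_submodule_eq:
  fixes J :: "'a::field mpol set"
  assumes J: "poly.idl n J" and fs: "set fs \<subseteq> polys n" and i: "i \<le> length fs"
    and f: "\<And>j. j < length fs \<Longrightarrow> f j = fs ! j"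
  shows "seq_submodule (ideal_module (poly_ring K n) J) (take i fs) = extend_seq J f {0} i"
proof -
  let ?M = "ideal_module (poly_ring K n) J"
  have len: "length (take i fs) = i" using i by simp
  have sum: "(\<Oplus>\<^bsub>?M\<^esub>j\<in>{..<i}. take i fs ! j \<odot>\<^bsub>?M\<^esub> w j) = (\<Sum>j<i. f j * w j)"
    if w: "\<forall>j<i. w j \<in> J" for w
  proof -
    have "finsum ?M (\<lambda>j. take i fs ! j \<odot>\<^bsub>?M\<^esub> w j) {..<i} = (\<Sum>j<i. take i fs ! j \<odot>\<^bsub>?M\<^esub> w j)"
    proof (rule finsum_ideal_module[OF J])
      fix j assume "j < i"
      moreover from this have "fs ! j \<in> polys n" using fs i by (meson less_le_trans nth_mem subsetD)
      ultimately show "take i fs ! j \<odot>\<^bsub>?M\<^esub> w j \<in> J" using w poly.idlD(4)[OF J] by simp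
    qed
    then show ?thesis using f i by simp
  qed
  have PiE: "w \<in> {..<i} \<rightarrow> carrier ?M \<longleftrightarrow> (\<forall>j<i. w j \<in> J)" for w by auto
  show ?thesis
    unfolding seq_submodule_def extend_seq_eq_sums len PiE
    using sum by (metis (no_types, lifting))
qed

lemma regular_sequence_iff:
  fixes J :: "'a::field mpol set"
  assumes J: "poly.idl n J" and fs: "set fs \<subseteq> polys n"
    and f: "\<And>j. j < length fs \<Longrightarrow> f j = fs ! j"
  shows "regular_sequence (poly_ring K n) (ideal_module (poly_ring K n) J) fs \<longleftrightarrow>
    wreg J f {0} (length fs) \<and> extend_seq J f {0} (length fs) \<noteq> J"
proof -
  have "seq_submodule (ideal_module (poly_ring K n) J) fs = extend_seq J f {0} (length fs)"
    using seq_submodule_eq[OF J fs order_refl f] by simp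
  then show ?thesis
    unfolding regular_sequence_def wreg_def using seq_submodule_eq[OF J fs _ f] fs f by (simp add: less_imp_le)
qed

lemma irrelevant_ideal_eq:
  "irrelevant_ideal K n = (monideal n (\<lambda>T. T \<noteq> {}) :: 'a::field mpol set)"
proof -
  have X: "X ` {1..n} = (sqmon ` ((\<lambda>i. {i}) ` {1..n}) :: 'a mpol set)"
    by (simp add: image_image X_eq_sqmon)
  have "irrelevant_ideal K n = monideal n (\<lambda>T. \<exists>E\<in>(\<lambda>i. {i}) ` {1..n}. E \<subseteq> T)"
    unfolding irrelevant_ideal_def X by (rule genideal_mon) auto
  also have "\<dots> = monideal n (\<lambda>T. T \<noteq> {})"
  proof (rule Set.set_eqI)
    have "(\<exists>E\<in>(\<lambda>i. {i}) ` {1..n}. E \<subseteq> T) \<longleftrightarrow> T \<noteq> {}" if "T \<subseteq> {1..n}" for T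
      using that by blast
    then show "f \<in> monideal n (\<lambda>T. \<exists>E\<in>(\<lambda>i. {i}) ` {1..n}. E \<subseteq> T) \<longleftrightarrow> f \<in> monideal n (\<lambda>T. T \<noteq> {})"
      for f :: "'a mpol"
      by (simp only: monideal_iff cong: conj_cong)
  qed
  finally show ?thesis .
qed

text \<open>Supplies the coefficients from which \<open>essential_step\<close> builds its
  homotopy.\<close>

lemma irrelevant_ideal_sum:
  fixes f :: "'a::field mpol"
  assumes "f \<in> irrelevant_ideal K n"
  shows "\<exists>a. (\<forall>l\<in>{1..n}. a l \<in> polys n) \<and> f = (\<Sum>l\<in>{1..n}. a l * X l)"
proof -
  define A where "A = {f :: 'a mpol. \<exists>a. (\<forall>l\<in>{1..n}. a l \<in> polys n) \<and> f = (\<Sum>l\<in>{1..n}. a l * X l)}"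
  have A: "poly.idl n A"
    unfolding poly.idl_def
  proof (intro conjI ballI)
    show "A \<subseteq> polys n"
      unfolding A_def by (auto intro!: poly.idl_sum[OF poly.idl_R] poly.mult_closed X_closed)
    show "0 \<in> A" unfolding A_def mem_Collect_eq
      by (rule exI[of _ "\<lambda>_. 0"]) (simp add: poly.zero_closed)
  next
    fix f g :: "'a mpol" assume "f \<in> A" "g \<in> A"
    then obtain a b where ab: "\<forall>l\<in>{1..n}. a l \<in> polys n" "f = (\<Sum>l\<in>{1..n}. a l * X l)"
      "\<forall>l\<in>{1..n}. b l \<in> polys n" "g = (\<Sum>l\<in>{1..n}. b l * X l)" unfolding A_def by blast
    then have "f + g = (\<Sum>l\<in>{1..n}. (a l + b l) * X l)" by (simp add: sum.distrib distrib_right)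
    moreover have "\<forall>l\<in>{1..n}. a l + b l \<in> polys n" using ab poly.add_closed by blast
    ultimately show "f + g \<in> A" unfolding A_def mem_Collect_eq by (intro exI[of _ "\<lambda>l. a l + b l"] conjI)
  next
    fix c f :: "'a mpol" assume c: "c \<in> polys n" and "f \<in> A"
    then obtain a where a: "\<forall>l\<in>{1..n}. a l \<in> polys n" "f = (\<Sum>l\<in>{1..n}. a l * X l)" unfolding A_def by blast
    then have "c * f = (\<Sum>l\<in>{1..n}. (c * a l) * X l)" by (simp add: sum_distrib_left mult.assoc)
    moreover have "\<forall>l\<in>{1..n}. c * a l \<in> polys n" using a c poly.mult_closed by blast
    ultimately show "c * f \<in> A" unfolding A_def mem_Collect_eq by (intro exI[of _ "\<lambda>l. c * a l"] conjI)
  qed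
  have "f \<in> A"
    using A assms[unfolded irrelevant_ideal_eq]
  proof (rule monideal_decompose)
    fix t :: "nat \<Rightarrow>\<^sub>0 nat" and c :: 'a
    assume t: "Poly_Mapping.keys t \<subseteq> {1..n}" "Poly_Mapping.keys t \<noteq> {}"
    then obtain i where i: "i \<in> Poly_Mapping.keys t" "i \<in> {1..n}" by blast
    let ?a = "\<lambda>l. if l = i then Poly_Mapping.single (t - sqf {i}) c else 0"
    have "Poly_Mapping.single t c = Poly_Mapping.single (t - sqf {i}) c * X i"
      using i(1) single_eq_sqmon_mult[of "{i}" t c] by (simp add: X_eq_sqmon)
    also have "\<dots> = (\<Sum>l\<in>{1..n}. ?a l * X l)"
      using i(2) by (simp add: if_distrib[where f = "\<lambda>y. y * _"] cong: if_cong)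
    finally have "Poly_Mapping.single t c = (\<Sum>l\<in>{1..n}. ?a l * X l)" .
    moreover have "Poly_Mapping.single (t - sqf {i}) c \<in> polys n"
      using subset_trans[OF keys_minus_subset t(1)] by (simp add: polys_iff)
    then have "\<forall>l\<in>{1..n}. ?a l \<in> polys n" by (simp add: poly.zero_closed)
    ultimately show "Poly_Mapping.single t c \<in> A" unfolding A_def mem_Collect_eq by (intro exI[of _ ?a] conjI)
  qed
  then show ?thesis by (simp add: A_def)
qed

lemma path_gen_eq: "path_gen m l i = (sqmon (edge (m - l) m i) :: 'a::field mpol)"
proof -
  have "edge (m - l) m i = (+) ((i - 1) * (m - l)) ` {1..m}" by (simp add: edge_def)
  then have "(\<Prod>x\<in>edge (m - l) m i. X x) = (\<Prod>j=1..m. X ((i - 1) * (m - l) + j) :: 'a mpol)"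
    by (simp only: prod.reindex[OF inj_on_add] o_def)
  then show ?thesis unfolding path_gen_def by (simp add: prod_X edge_def)
qed

lemma path_ideal_eq:
  assumes "\<And>i. i \<in> {1..k} \<Longrightarrow> edge (m - l) m i \<subseteq> {1..n}"
  shows "path_ideal K n m l k = (monideal n (\<lambda>T. \<exists>E\<in>edge (m - l) m ` {1..k}. E \<subseteq> T) :: 'a::field mpol set)"
proof -
  have gens: "path_gen m l ` {1..k} = (sqmon ` (edge (m - l) m ` {1..k}) :: 'a mpol set)"
    by (simp add: image_image path_gen_eq)
  show ?thesis unfolding path_ideal_def gens by (rule genideal_mon) (use assms in blast)
qed

text \<open>A degree argument in place of Nakayama: the ideal starts in degree \<open>m\<close>, the
  symmetric polynomials have positive degree, and so the generator \<open>sqmon S\<close> of degree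
  \<open>m\<close> is not reached.\<close>

lemma extend_seq_esym_neq:
  fixes U :: "nat set \<Rightarrow> bool"
  assumes U: "\<And>T. U T \<Longrightarrow> finite T \<Longrightarrow> m \<le> card T" and S: "S \<subseteq> {1..n}" "card S = m" "U S"
  shows "extend_seq (monideal n U) (\<lambda>i. esym n (Suc i)) {0} r \<noteq> (monideal n U :: 'a::field mpol set)"
proof -
  let ?M = "monideal n U :: 'a mpol set"
  have low: "trunc n j v = 0" if v: "v \<in> ?M" and j: "j \<le> m" for v j
  proof (rule poly_mapping_eqI)
    fix t
    have "j \<le> deg n t" if t: "t \<in> Poly_Mapping.keys v"
    proof -
      have keys: "Poly_Mapping.keys t \<subseteq> {1..n}" "U (Poly_Mapping.keys t)"
        using v t by (simp_all only: monideal_iff)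
      have "card (Poly_Mapping.keys t) = (\<Sum>i\<in>Poly_Mapping.keys t. 1)" by simp
      also have "\<dots> \<le> (\<Sum>i\<in>Poly_Mapping.keys t. Poly_Mapping.lookup t i)"
        by (rule sum_mono) (simp add: in_keys_iff)
      also have "\<dots> \<le> deg n t" unfolding deg_def by (rule sum_mono2[OF _ keys(1)]) auto
      finally show ?thesis using U[OF keys(2)] j by simp
    qed
    then have "Poly_Mapping.lookup v t = 0" if "deg n t < j"
      using that by (meson in_keys_iff not_le)
    then show "Poly_Mapping.lookup (trunc n j v) t = Poly_Mapping.lookup 0 t"
      by (simp add: lookup_trunc)
  qed
  have ext: "trunc n (Suc m) v = 0" if "v \<in> extend_seq ?M (\<lambda>i. esym n (Suc i)) {0} r" for v
    using that
  proof (induction r arbitrary: v)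
    case 0
    then show ?case by (auto intro: poly_mapping_eqI simp: lookup_trunc)
  next
    case (Suc r)
    then obtain a w where "v = a + esym n (Suc r) * w" "w \<in> ?M" "trunc n (Suc m) a = 0" by auto
    then show ?case by (simp add: trunc_add trunc_homog_mult[OF homog_esym] low)
  qed
  have fin: "finite S" using S(1) finite_subset by blast
  have "sqmon S \<in> ?M" using S fin by (simp add: monideal_iff keys_sqf)
  moreover have "Poly_Mapping.lookup (trunc n (Suc m) (sqmon S :: 'a mpol)) (sqf S) = 1"
    using S by (simp add: lookup_trunc deg_sqf sqmon_def)
  then have "sqmon S \<notin> extend_seq ?M (\<lambda>i. esym n (Suc i)) {0} r" using ext by fastforce
  ultimately show ?thesis by metis
qed

text \<open>Ensures that the natural subtraction \<open>n - p\<close> is exact and equals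
  \<open>Suc (n - (p + 1))\<close>. The bound comes from \<open>p \<le> k - 1\<close> and
  \<open>m \<ge> 1\<close>.\<close>

lemma path_codepth_less:
  fixes d q s k n m a r p :: nat
  assumes m: "m = q * d + s" and s: "s < d" and q: "1 \<le> q" and n: "n = (k - 1) * d + m"
    and k: "k = 1 + a * (q + 1) + r" and p: "p = 2 * a + of_bool (0 < r)"
  shows "p + 1 \<le> n"
proof -
  have "p \<le> k - 1"
  proof -
    have "a * 2 \<le> a * (q + 1)" using q by simp
    moreover have "of_bool (0 < r) \<le> r" by simp
    ultimately show ?thesis using k p by linarith
  qed
  moreover have "0 < q * d" using s q by simp
  then have "1 \<le> m" using m by linarith
  moreover have "k - 1 \<le> (k - 1) * d" using s by simp
  ultimately show ?thesis using n by linarith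
qed

lemma depth_path:
  fixes K :: "'a::field itself" and d q s k n m l a r p :: nat
  assumes m: "m = q * d + s" and s: "s < d" and q: "1 \<le> q" and d: "d = m - l"
    and n: "n = (k - 1) * d + m"
    and k: "k = 1 + a * (q + 1) + r" and r: "r \<le> q" and p: "p = 2 * a + of_bool (0 < r)"
  shows "depth (poly_ring K n) (irrelevant_ideal K n)
    (ideal_module (poly_ring K n) (path_ideal K n m l k)) = enat (n - p)"
proof -
  let ?R = "poly_ring K n" and ?U = "\<lambda>T. \<exists>E\<in>edge d m ` {1..k}. E \<subseteq> T"
  let ?I = "monideal n ?U :: 'a mpol set" and ?f = "\<lambda>i. esym n (Suc i) :: 'a mpol"
  have edge_sub: "edge d m i \<subseteq> {1..n}" if "i \<in> {1..k}" for i
  proof -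
    have "(i - 1) * d \<le> (k - 1) * d" using that by (intro mult_le_mono1) auto
    then show ?thesis using n by (auto simp: edge_def)
  qed
  have I_eq: "path_ideal K n m l k = ?I"
    using path_ideal_eq[of k m l n K] edge_sub unfolding d by blast
  have I: "poly.idl n ?I" by (rule idl_monideal) (auto simp: upward_def)
  have pn: "p + 1 \<le> n" by (rule path_codepth_less[OF m s q n k p])
  have "length fs \<le> n - p" if fs: "set fs \<subseteq> irrelevant_ideal K n" "regular_sequence ?R (ideal_module ?R ?I) fs" for fs
  proof -
    \<comment> \<open>\<open>wreg\<close> takes a sequence on all naturals, so the list is continued
      by zero.\<close>
    let ?h = "\<lambda>j. if j < length fs then fs ! j else 0"
    have fsR: "set fs \<subseteq> polys n" using fs(2) by (simp add: regular_sequence_def)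
    have wreg: "wreg ?I ?h {0} (length fs)"
      using regular_sequence_iff[OF I fsR, of ?h] fs(2) by auto
    obtain z where z: "poly.essential {1..n} X ?I {0} p z"
      using essential_path[OF m s q _ k r p, of n] n by auto
    have closed: "?h i \<in> polys n" for i
      using fsR nth_mem[of i fs] by (auto simp: poly.zero_closed)
    have sums: "\<exists>a. (\<forall>l\<in>{1..n}. a l \<in> polys n) \<and> ?h i = (\<Sum>l\<in>{1..n}. a l * X l)" if "i < length fs" for i
    proof -
      have "fs ! i \<in> irrelevant_ideal K n" using fs(1) nth_mem[OF that] by blast
      from irrelevant_ideal_sum[OF this] show ?thesis using that by simp
    qed
    have "p + length fs \<le> card {1..n}"
      by (rule poly.essential_wreg_length[OF I _ X_closed closed sums wreg z]) simp_all
    then show ?thesis by simp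
  qed
  then have upper: "enat (length fs) \<le> enat (n - p)"
    if "set fs \<subseteq> irrelevant_ideal K n" "regular_sequence ?R (ideal_module ?R ?I) fs" for fs
    using that by simp
  define fs where "fs = map ?f [0..<n - p]"
  have len: "length fs = n - p" and nth: "\<And>j. j < length fs \<Longrightarrow> ?f j = fs ! j" by (simp_all add: fs_def)
  have fsR: "set fs \<subseteq> polys n" by (auto simp: fs_def esym_closed)
  have "?f i \<in> irrelevant_ideal K n" for i
    unfolding irrelevant_ideal_eq monideal_def
  proof (intro CollectI conjI ballI esym_closed)
    fix t assume "t \<in> Poly_Mapping.keys (?f i)"
    then obtain S where S: "t = sqf S" "S \<subseteq> {1..n}" "card S = Suc i" by (rule keys_esym)
    then have "finite S" using finite_subset by blast
    then show "Poly_Mapping.keys t \<noteq> {}" using S by (auto simp: keys_sqf)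
  qed
  then have fsJ: "set fs \<subseteq> irrelevant_ideal K n" by (auto simp: fs_def)
  have "wreg (polys n) ?f ?I (n - (p + 1))"
    using wreg_esym_path[OF m s _ k r, of n, where 'a = 'a] n p by simp
  \<comment> \<open>The case of the zero prime: all \<open>n\<close> symmetric polynomials are
    regular on \<open>R\<close> itself.\<close>
  moreover have "monideal n (\<lambda>T. T \<inter> {} \<noteq> {}) = ({0} :: 'a mpol set)"
    by (auto simp: monideal_iff)
  then have "wreg (polys n) ?f {0} n" using wreg_esym_prime[of "{}" n, where 'a = 'a] by simp
  then have "wreg (polys n) ?f {0} (Suc (n - (p + 1)))" by (rule wreg_mono) (use pn in simp)
  ultimately have "wreg ?I ?f {0} (Suc (n - (p + 1)))"
    by (rule poly.wreg_module[OF I esym_closed])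
  then have wreg: "wreg ?I ?f {0} (length fs)" using pn by (simp add: len Suc_diff_Suc)
  have k1: "1 \<in> {1..k}" using k by simp
  have "extend_seq ?I ?f {0} (length fs) \<noteq> ?I"
  proof (rule extend_seq_esym_neq[of _ m])
    show "m \<le> card T" if T: "?U T" "finite T" for T
    proof -
      obtain i where "edge d m i \<subseteq> T" using T(1) by blast
      from card_mono[OF T(2) this] show ?thesis by (simp add: edge_def)
    qed
    show "edge d m 1 \<subseteq> {1..n}" by (rule edge_sub[OF k1])
    show "card (edge d m 1) = m" by (simp add: edge_def)
    show "?U (edge d m 1)" using k1 by blast
  qed
  then have reg: "regular_sequence ?R (ideal_module ?R ?I) fs"
    using regular_sequence_iff[OF I fsR nth] wreg by blast
  show "depth ?R (irrelevant_ideal K n) (ideal_module ?R (path_ideal K n m l k)) = enat (n - p)"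
    unfolding depth_def I_eq
  proof (rule antisym)
    show "Sup {enat (length fs) | fs. set fs \<subseteq> irrelevant_ideal K n \<and> regular_sequence ?R (ideal_module ?R ?I) fs} \<le> enat (n - p)"
      by (rule Sup_least) (use upper in blast)
    show "enat (n - p) \<le> Sup {enat (length fs) | fs. set fs \<subseteq> irrelevant_ideal K n \<and> regular_sequence ?R (ideal_module ?R ?I) fs}"
      by (rule Sup_upper) (use fsJ reg len in force)
  qed
qed

theorem corollary3p11:
  fixes K :: "'a::field itself" and k l m n s :: nat
  assumes "n = k * (m - l) + l"
    and "k \<ge> 1" and "m \<ge> 2"
    and "\<lceil>real m / 2\<rceil> \<le> int l" and "l < m"
    and "[m = s] (mod (m - l))"
    and "1 \<le> s" and "s < m - l"
  shows "ereal_of_enat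
      (depth (poly_ring K n) (irrelevant_ideal K n)
        (ideal_module (poly_ring K n) (path_ideal K n m l k))) =
    ereal (real_of_int
      (int n + 2
        - \<lceil>(real n + real m - real l - real s) / (2 * real m - real l - real s)\<rceil>
        - \<lfloor>(real n + real m - real l - real s) / (2 * real m - real l - real s)\<rfloor>))"
proof -
  define d where "d = m - l"
  define q where "q = m div d"
  define a where "a = (k - 1) div (q + 1)"
  define r where "r = (k - 1) mod (q + 1)"
  define p :: nat where "p = 2 * a + of_bool (0 < r)"
  have s: "s < d" using assms(8) by (simp add: d_def)
  have "m mod d = s" using assms(6) s by (simp add: cong_def d_def)
  then have m: "m = q * d + s" unfolding q_def by (metis div_mult_mod_eq)
  have "real m / 2 \<le> real l" using assms(4) by linarith
  then have "d \<le> m" by (simp add: d_def)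
  then have q: "1 \<le> q" using s unfolding q_def by (simp add: div_greater_zero_iff Suc_le_eq)
  obtain k' where k': "k = Suc k'" using assms(2) by (cases k) auto
  have ml: "m = d + l" using assms(5) by (simp add: d_def)
  have n: "n = (k - 1) * d + m" using assms(1) ml by (simp add: k' flip: d_def)
  have k: "k = 1 + a * (q + 1) + r"
    using div_mult_mod_eq[of "k - 1" "q + 1"] assms(2) unfolding a_def r_def by linarith
  have r: "r \<le> q" by (simp add: r_def flip: less_Suc_eq_le)
  have dp: "depth (poly_ring K n) (irrelevant_ideal K n)
      (ideal_module (poly_ring K n) (path_ideal K n m l k)) = enat (n - p)"
    by (rule depth_path[OF m s q d_def n k r p_def])
  have pn: "p + 1 \<le> n" by (rule path_codepth_less[OF m s q n k p_def])
  let ?Q = "(real n + real m - real l - real s) / (2 * real m - real l - real s)"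
  \<comment> \<open>With \<open>m - l = d\<close> and \<open>m - s = q * d\<close>, the numerator is
    \<open>(k + q) * d\<close> and the denominator \<open>(q + 1) * d\<close>.\<close>
  have "real n + real m - real l - real s = (real k + real q) * real d"
    unfolding assms(1) d_def[symmetric] using m ml by (simp add: algebra_simps flip: of_nat_mult of_nat_add)
  moreover have "2 * real m - real l - real s = (real q + 1) * real d"
  proof -
    have "real m = real q * real d + real s" "real m = real d + real l" by (subst m ml, simp)+
    then show ?thesis by (simp add: algebra_simps)
  qed
  ultimately have "?Q = (real k + real q) / (real q + 1)" using s by simp
  also have "real k + real q = (real a + 1) * (real q + 1) + real r" unfolding k by (simp add: algebra_simps)
  also have "\<dots> / (real q + 1) = real a + 1 + real r / (real q + 1)" by (simp add: add_divide_distrib)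
  finally have Q: "?Q = real a + 1 + real r / (real q + 1)" .
  have lt: "real r / (real q + 1) < 1" using r by simp
  have ge: "0 \<le> real r / (real q + 1)" by simp
  have fl: "\<lfloor>?Q\<rfloor> = int a + 1" unfolding Q using lt ge by (intro floor_unique) auto
  have ce: "\<lceil>?Q\<rceil> = int a + 1 + of_bool (0 < r)"
  proof (cases "r = 0")
    case True
    then show ?thesis unfolding Q by simp
  next
    case False
    then have "0 < real r / (real q + 1)" by simp
    then show ?thesis unfolding Q using lt False by (intro ceiling_unique) auto
  qed
  \<comment> \<open>Floor and ceiling add up to \<open>2 * a + 2\<close>, plus one if
    \<open>r > 0\<close>, that is, to \<open>p + 2\<close>.\<close>
  have "int n + 2 - \<lceil>?Q\<rceil> - \<lfloor>?Q\<rfloor> = int (n - p)"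
    unfolding fl ce using pn by (simp add: p_def of_nat_diff)
  then show ?thesis by (simp add: dp)
qed

end
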